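(* For every integer $n > 3$ there exists a constant $c_n > 0$ such that any non-crossing arrangement $\mathcal{A}$ of bodies in the plane, in which every triple is convexly independent, contains a convex $n$-clustering of size $\lfloor c_n |\mathcal{A}| \rfloor$.
   Context: A body is a nonempty compact convex subset of $\mathbb{R}^2$, and an arrangement is a finite family of bodies. A family of bodies is convexly independent if no member is contained in the convex hull of the union of the other members. An arrangement is non-crossing if for any two of its members $A$ and $B$ the set $A\setminus B$ is simply connected (and likewise $B \setminus A$). A convex $n$-clustering of bodies is a disjoint union of families of bodies $\mathcal{S}_1, \mathcal{S}_2, \dots, \mathcal{S}_n$ of equal cardinality such that every $n$-tuple $(S_1, \dots, S_n)$ with $S_i \in \mathcal{S}_i$ is convexly independent. The common cardinality of the $\mathcal{S}_i$ is the size of the clustering; a clustering of size $0$ (all $\mathcal{S}_i$ empty) is allowed. An arrangement $\mathcal{A}$ contains the clustering if $\mathcal{S}_1 \cup \dots \cup \mathcal{S}_n \subset \mathcal{A}$. *)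

theory Defs
  imports "HOL-Analysis.Analysis"
begin

definition body :: "(real^2) set \<Rightarrow> bool" where
  "body K \<longleftrightarrow> K \<noteq> {} \<and> compact K \<and> convex K"

definition arrangement :: "(real^2) set set \<Rightarrow> bool" where
  "arrangement \<A> \<longleftrightarrow> finite \<A> \<and> (\<forall>K\<in>\<A>. body K)"

definition convexly_independent :: "(real^2) set set \<Rightarrow> bool" where
  "convexly_independent \<F> \<longleftrightarrow> (\<forall>K\<in>\<F>. \<not> K \<subseteq> convex hull (\<Union>(\<F> - {K})))"

text \<open>\<^const>\<open>pairwise\<close> ranges over ordered pairs of distinct members, so both \<open>A - B\<close> and
  \<open>B - A\<close> are covered. The library's \<^const>\<open>simply_connected\<close> includes path-connectedness
  and counts the empty set as simply connected.\<close>

definition non_crossing :: "(real^2) set set \<Rightarrow> bool" where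
  "non_crossing \<A> \<longleftrightarrow> pairwise (\<lambda>A B. simply_connected (A - B)) \<A>"

text \<open>Finiteness is explicit because \<^const>\<open>card\<close> is \<open>0\<close> on infinite sets. As the classes are
  disjoint, the members \<open>s 1, \<dots>, s n\<close> of a tuple are distinct, so the tuple may be identified
  with the set of its members.\<close>

definition convex_clustering :: "nat \<Rightarrow> nat \<Rightarrow> (nat \<Rightarrow> (real^2) set set) \<Rightarrow> bool" where
  "convex_clustering n k \<S> \<longleftrightarrow>
     (\<forall>i\<in>{1..n}. finite (\<S> i) \<and> card (\<S> i) = k \<and> (\<forall>K\<in>\<S> i. body K)) \<and>
     disjoint_family_on \<S> {1..n} \<and>
     (\<forall>s. (\<forall>i\<in>{1..n}. s i \<in> \<S> i) \<longrightarrow> convexly_independent (s ` {1..n}))"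

definition contains_convex_clustering :: "(real^2) set set \<Rightarrow> nat \<Rightarrow> nat \<Rightarrow> bool" where
  "contains_convex_clustering \<A> n k \<longleftrightarrow>
     (\<exists>\<S>. convex_clustering n k \<S> \<and> (\<Union>i\<in>{1..n}. \<S> i) \<subseteq> \<A>)"

end

theory Submission
  imports Defs "HOL-Library.Ramsey"
begin

text \<open>Replace each body \<open>A\<close> by its height function, the support function along the circle of
  directions. As \<open>A - B\<close> is connected, \<open>A\<close> is higher than \<open>B\<close> exactly on an arc. Cut the circle at
  \<open>0\<close> and order the bodies by decreasing height there: a later body exceeds an earlier one on an
  interval, and the triple condition makes the intervals of one body meet pairwise, so by Helly's
  theorem on the line it exceeds all earlier bodies somewhere. A later body \<open>j\<close> beats \<open>k\<close> on an
  interval lying to one side of a point where \<open>k\<close> beats both \<open>i\<close> and \<open>j\<close>; Ramsey's theorem makes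
  the side the same for all \<open>i < k < j\<close>, and then \<open>k\<close> has a direction in which it beats all others.

  For a positive fraction, take a Ramsey number \<open>K\<close> of groups that are separated at \<open>0\<close>. Every
  transversal contains such a chain of length \<open>3 n + 1\<close>; by pigeonhole, many transversals have their
  chain at the same places and agree except at every third place of it. The bodies fixed in between
  separate the varying ones, which may therefore be chosen independently of each other.\<close>

section \<open>Ramsey's theorem for increasing triples and Helly's theorem on the line\<close>

lemma increasing_triple_eq:
  fixes a b c :: "'a::linorder"
  assumes "a < b" "b < c" "a' < b'" "b' < c'" and eq: "{a, b, c} = {a', b', c'}"
  shows "a = a' \<and> b = b' \<and> c = c'"
proof -
  have "[a, b, c] = [a', b', c']"
    using assms by (intro sorted_distinct_set_unique) auto
  then show ?thesis by simp
qed

text \<open>An increasing triple is determined by its underlying set, so colouring such triples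
  amounts to colouring 3-sets. The order-preserving enumeration of \<open>S\<close> carries Ramsey's
  theorem from an initial segment of the naturals to \<open>S\<close>.\<close>

lemma Ramsey_increasing_triples:
  "\<exists>N. \<forall>S::nat set. \<forall>col :: nat \<Rightarrow> nat \<Rightarrow> nat \<Rightarrow> bool. finite S \<and> N \<le> card S \<longrightarrow>
    (\<exists>H b. H \<subseteq> S \<and> card H = M \<and> (\<forall>i\<in>H. \<forall>j\<in>H. \<forall>k\<in>H. i < j \<longrightarrow> j < k \<longrightarrow> col i j k = b))"
proof -
  obtain N where N: "partn_lst {..<N::nat} [M, M] 3"
    using ramsey_full by blast
  show ?thesis
  proof (rule exI[of _ N], intro allI impI, elim conjE)
    fix S :: "nat set" and col :: "nat \<Rightarrow> nat \<Rightarrow> nat \<Rightarrow> bool"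
    assume S: "finite S" "N \<le> card S"
    define h where "h = enumerate S"
    have h: "bij_betw h {..<card S} S"
      unfolding h_def using S(1) by (rule finite_bij_enumerate)
    have h_mono: "strict_mono_on {..<card S} h"
      unfolding h_def using S(1) finite_enumerate_mono by (intro strict_mono_onI) auto
    \<comment> \<open>Colour 0 encodes that \<open>col\<close> holds.\<close>
    define f where "f E = (if \<exists>a b c. a < b \<and> b < c \<and> E = {a, b, c} \<and> col (h a) (h b) (h c)
      then 0 else 1 :: nat)" for E
    have f_eq: "f {a, b, c} = 0 \<longleftrightarrow> col (h a) (h b) (h c)" if "a < b" "b < c" for a b c
    proof -
      have "col (h a) (h b) (h c)"
        if "a' < b'" "b' < c'" "{a, b, c} = {a', b', c'}" "col (h a') (h b') (h c')" for a' b' c'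
        using increasing_triple_eq[OF \<open>a < b\<close> \<open>b < c\<close> that(1-3)] that(4) by simp
      then show ?thesis unfolding f_def using that by auto
    qed
    have "f \<in> nsets {..<N} 3 \<rightarrow> {..<2}" by (auto simp: f_def)
    then obtain i H where i: "i < length [M, M]" and H: "H \<in> nsets {..<N} ([M, M] ! i)"
      and mono: "f ` nsets H 3 \<subseteq> {i}"
      by (rule partn_lstE[OF N]) auto
    have HN: "H \<subseteq> {..<N}" "card H = M" "finite H"
      using H i by (auto simp: nsets_def less_Suc_eq)
    have Hsub: "H \<subseteq> {..<card S}" using HN S by auto
    have inj: "inj_on h H" using h Hsub by (meson bij_betw_imp_inj_on inj_on_subset)
    have "col (h a) (h b) (h c) = (i = 0)"
      if "a \<in> H" "b \<in> H" "c \<in> H" "a < b" "b < c" for a b c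
    proof -
      have "{a, b, c} \<in> nsets H 3" using that by (auto simp: nsets_def)
      then have "f {a, b, c} = i" using mono by blast
      then show ?thesis using f_eq[OF that(4,5)] by auto
    qed
    moreover have "a < b \<longleftrightarrow> h a < h b" if "a \<in> H" "b \<in> H" for a b
      using h_mono Hsub that by (metis strict_mono_on_less subsetD)
    ultimately have "\<forall>i'\<in>h`H. \<forall>j\<in>h`H. \<forall>k\<in>h`H. i' < j \<longrightarrow> j < k \<longrightarrow> col i' j k = (i = 0)"
      by auto
    moreover have "h ` H \<subseteq> S" using h Hsub by (auto simp: bij_betw_def)
    moreover have "card (h ` H) = M" using inj HN by (simp add: card_image)
    ultimately show "\<exists>H b. H \<subseteq> S \<and> card H = M \<and>
        (\<forall>i\<in>H. \<forall>j\<in>H. \<forall>k\<in>H. i < j \<longrightarrow> j < k \<longrightarrow> col i j k = b)"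
      by (intro exI[of _ "h ` H"] exI[of _ "i = 0"] conjI)
  qed
qed

text \<open>In dimension one Helly's theorem asks only for pairwise intersections. It counts sets,
  not indices, so the case where all \<open>C i\<close> coincide is split off; there the instance
  \<open>i = j\<close> of \<open>meet\<close> gives nonemptiness.\<close>

lemma Helly_real:
  fixes C :: "'a \<Rightarrow> real set"
  assumes "finite I" "I \<noteq> {}" and conv: "\<And>i. i \<in> I \<Longrightarrow> convex (C i)"
    and meet: "\<And>i j. i \<in> I \<Longrightarrow> j \<in> I \<Longrightarrow> C i \<inter> C j \<noteq> {}"
  shows "(\<Inter>i\<in>I. C i) \<noteq> {}"
proof (cases "card (C ` I) \<ge> 2")
  case True
  show ?thesis
  proof (rule Helly)
    show "DIM(real) + 1 \<le> card (C ` I)" using True by simp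
    show "\<forall>s\<in>C ` I. convex s" using conv by blast
    fix t assume t: "t \<subseteq> C ` I" "card t = DIM(real) + 1"
    from t(2) have "card t = 2" by simp
    then obtain A B where AB: "t = {A, B}" unfolding card_2_iff by blast
    then have "A \<in> C ` I" "B \<in> C ` I" using t(1) by blast+
    then obtain i j where "i \<in> I" "j \<in> I" "A = C i" "B = C j" by blast
    then show "\<Inter>t \<noteq> {}" using meet[of i j] unfolding AB by simp
  qed
next
  case False
  then have le1: "card (C ` I) \<le> Suc 0" by simp
  obtain i where i: "i \<in> I" using \<open>I \<noteq> {}\<close> by blast
  have "C j = C i" if "j \<in> I" for j
    using card_le_Suc0_iff_eq[of "C ` I"] \<open>finite I\<close> that i le1 by blast
  then have "(\<Inter>j\<in>I. C j) = C i" using i by blast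
  then show ?thesis using meet[OF i i] by simp
qed

section \<open>Chains of functions on a line\<close>

text \<open>The strict version feeds Helly's theorem. The weak one puts all points where
  \<open>b\<close> is at least \<open>a\<close> on one side of any point where \<open>a\<close> is
  higher.\<close>

definition before :: "real set \<Rightarrow> (real \<Rightarrow> real) \<Rightarrow> (real \<Rightarrow> real) \<Rightarrow> bool" where
  "before T a b \<longleftrightarrow> convex {t \<in> T. a t < b t} \<and> convex {t \<in> T. a t \<le> b t}"

text \<open>The restriction \<open>i < k\<close> is what bodies can guarantee: at the cut
  \<open>i\<close> is higher than \<open>k\<close>, so a direction in which \<open>k\<close> beats
  \<open>i\<close> is not the cut and lies in \<open>T\<close>.\<close>

definition admissible :: "real set \<Rightarrow> nat set \<Rightarrow> (nat \<Rightarrow> real \<Rightarrow> real) \<Rightarrow> bool" where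
  "admissible T I y \<longleftrightarrow>
     (\<forall>i\<in>I. \<forall>j\<in>I. i < j \<longrightarrow> before T (y i) (y j)) \<and>
     (\<forall>i\<in>I. \<forall>j\<in>I. \<forall>k\<in>I. i < k \<longrightarrow> j \<noteq> k \<longrightarrow> (\<exists>t\<in>T. y i t < y k t \<and> y j t < y k t))"

text \<open>At \<open>w k\<close> the function \<open>y k\<close> is on top of the whole family.
  Domination of the later functions on everything to the left, and not only at \<open>w k\<close>,
  is what puts the witnesses in increasing order.\<close>

definition chain :: "real set \<Rightarrow> nat set \<Rightarrow> (nat \<Rightarrow> real \<Rightarrow> real) \<Rightarrow> (nat \<Rightarrow> real) \<Rightarrow> bool" where
  "chain T H y w \<longleftrightarrow> (\<forall>k\<in>H. w k \<in> T \<and> (\<forall>i\<in>H. i < k \<longrightarrow> y i (w k) < y k (w k)) \<and>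
     (\<forall>j\<in>H. k < j \<longrightarrow> (\<forall>t\<in>T. t \<le> w k \<longrightarrow> y j t < y k t)))"

text \<open>The value \<open>b\<close> records how two earlier functions are ordered at a later
  witness; \<open>chain_exchange\<close> consults it when \<open>x' < x\<close>.\<close>

definition uniform_chain ::
  "real set \<Rightarrow> bool \<Rightarrow> nat set \<Rightarrow> (nat \<Rightarrow> real \<Rightarrow> real) \<Rightarrow> (nat \<Rightarrow> real) \<Rightarrow> bool" where
  "uniform_chain T b H y w \<longleftrightarrow> chain T H y w \<and>
     (\<forall>i\<in>H. \<forall>j\<in>H. \<forall>k\<in>H. i < j \<longrightarrow> j < k \<longrightarrow> (y i (w k) < y j (w k)) = b)"

lemma admissible_subset: "admissible T I y \<Longrightarrow> H \<subseteq> I \<Longrightarrow> admissible T H y"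
  unfolding admissible_def by blast

lemma chain_subset: "chain T H y w \<Longrightarrow> H' \<subseteq> H \<Longrightarrow> chain T H' y w"
  unfolding chain_def by (meson subsetD)

lemma uniform_chain_subset: "uniform_chain T b H y w \<Longrightarrow> H' \<subseteq> H \<Longrightarrow> uniform_chain T b H' y w"
  unfolding uniform_chain_def using chain_subset by (meson subsetD)

lemma chain_top:
  assumes "chain T H y w" "k \<in> H" "i \<in> H" "i \<noteq> k"
  shows "y i (w k) < y k (w k)"
  using assms unfolding chain_def by (metis linorder_neqE_nat order_refl)

text \<open>The least element is dropped because nothing earlier forces the sets
  \<open>{t \<in> T. \<forall>u\<in>T. u \<le> t \<longrightarrow> y j u < y k u}\<close> to be nonempty.\<close>

lemma chain_exists:
  assumes T: "convex T" and "finite H" and adm: "admissible T H y"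
    and left: "\<And>i k j. i \<in> H \<Longrightarrow> k \<in> H \<Longrightarrow> j \<in> H \<Longrightarrow> i < k \<Longrightarrow> k < j \<Longrightarrow>
      \<exists>t\<in>T. y i t < y k t \<and> (\<forall>u\<in>T. u \<le> t \<longrightarrow> y j u < y k u)"
  shows "\<exists>w. chain T (H - {Min H}) y w"
proof -
  have "\<exists>w. w \<in> T \<and> (\<forall>i\<in>H. i < k \<longrightarrow> y i w < y k w) \<and>
      (\<forall>j\<in>H. k < j \<longrightarrow> (\<forall>t\<in>T. t \<le> w \<longrightarrow> y j t < y k t))"
    if k: "k \<in> H" "k \<noteq> Min H" for k
  proof -
    define m where "m = Min H"
    have "m \<in> H" using k \<open>finite H\<close> Min_in unfolding m_def by blast
    moreover have "m \<le> k" "m \<noteq> k" using k \<open>finite H\<close> by (auto simp: m_def)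
    ultimately have m: "m \<in> H" "m < k" by auto
    \<comment> \<open>A point common to all these intervals can serve as \<open>w k\<close>. For a
      later \<open>i\<close> the interval is closed downward in \<open>T\<close>.\<close>
    define C where "C i = (if i < k then {t \<in> T. y i t < y k t}
      else {t \<in> T. \<forall>u\<in>T. u \<le> t \<longrightarrow> y i u < y k u})" for i
    have C_less: "C i = {t \<in> T. y i t < y k t}" if "i < k" for i using that by (simp add: C_def)
    have C_greater: "C i = {t \<in> T. \<forall>u\<in>T. u \<le> t \<longrightarrow> y i u < y k u}" if "k < i" for i
      using that by (simp add: C_def)
    have ne: "C i \<inter> C j \<noteq> {}" if "i \<in> H" "j \<in> H" "i < k" "j \<noteq> k" for i j
    proof (cases "j < k")
      case True
      then show ?thesis using adm k that unfolding admissible_def C_less[OF that(3)] C_less[OF True]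
        by blast
    next
      case False
      then have "k < j" using that by simp
      then show ?thesis using left[OF that(1) k(1) that(2,3)]
        unfolding C_less[OF that(3)] C_greater[OF \<open>k < j\<close>] by blast
    qed
    have "(\<Inter>i\<in>H-{k}. C i) \<noteq> {}"
    proof (rule Helly_real)
      show "finite (H - {k})" using \<open>finite H\<close> by simp
      show "H - {k} \<noteq> {}" using m by auto
      show "convex (C i)" if "i \<in> H - {k}" for i
      proof (cases "i < k")
        case True
        then show ?thesis using adm k that unfolding admissible_def before_def C_less[OF True] by blast
      next
        case False
        then have "k < i" using that by auto
        have "is_interval T" using T by (simp add: is_interval_convex_1)
        then have "is_interval (C i)"
          unfolding C_greater[OF \<open>k < i\<close>] is_interval_1 by (smt (verit) mem_Collect_eq)
        then show ?thesis by (simp add: is_interval_convex_1)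
      qed
      fix i j assume ij: "i \<in> H - {k}" "j \<in> H - {k}"
      show "C i \<inter> C j \<noteq> {}"
      proof (cases "i < k \<or> j < k")
        case True
        then show ?thesis using ne ij by (metis DiffD1 DiffD2 Int_commute singletonI)
      next
        case False
        then have "k < i" "k < j" using ij by auto
        \<comment> \<open>Meeting \<open>C m\<close> makes both sets nonempty; as they are closed
          downward, the smaller of two chosen points lies in both.\<close>
        have "C m \<inter> C i \<noteq> {}" "C m \<inter> C j \<noteq> {}" using ne m ij by auto
        then obtain a b where ab: "a \<in> C i" "b \<in> C j" by blast
        then have "min a b \<in> C i \<inter> C j"
          unfolding C_greater[OF \<open>k < i\<close>] C_greater[OF \<open>k < j\<close>] by (auto simp: min_def)
        then show ?thesis by blast
      qed
    qed
    then obtain t where t: "\<And>i. i \<in> H - {k} \<Longrightarrow> t \<in> C i" by blast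
    show ?thesis
    proof (intro exI conjI ballI impI)
      show "t \<in> T" using t[of m] m C_less by auto
      show "y i t < y k t" if "i \<in> H" "i < k" for i using t[of i] C_less that by auto
      show "y j u < y k u" if "j \<in> H" "k < j" "u \<in> T" "u \<le> t" for j u
        using t[of j] C_greater that by auto
    qed
  qed
  then have "\<forall>k. \<exists>w. k \<in> H - {Min H} \<longrightarrow> w \<in> T \<and> (\<forall>i\<in>H. i < k \<longrightarrow> y i w < y k w) \<and>
      (\<forall>j\<in>H. k < j \<longrightarrow> (\<forall>t\<in>T. t \<le> w \<longrightarrow> y j t < y k t))"
    by blast
  then obtain w where "\<forall>k. k \<in> H - {Min H} \<longrightarrow> w k \<in> T \<and> (\<forall>i\<in>H. i < k \<longrightarrow> y i (w k) < y k (w k)) \<and>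
      (\<forall>j\<in>H. k < j \<longrightarrow> (\<forall>t\<in>T. t \<le> w k \<longrightarrow> y j t < y k t))"
    by metis
  then show ?thesis unfolding chain_def by (intro exI[of _ w]) blast
qed

text \<open>At some point \<open>k\<close> beats both \<open>i\<close> and \<open>j\<close>. The
  points where \<open>j\<close> is at least \<open>k\<close> form an interval that misses this
  point, hence lie entirely to one side of it.\<close>

lemma left_or_right:
  assumes adm: "admissible T H y" and "i \<in> H" "k \<in> H" "j \<in> H" "i < k" "k < j"
  shows "(\<exists>t\<in>T. y i t < y k t \<and> (\<forall>u\<in>T. u \<le> t \<longrightarrow> y j u < y k u)) \<or>
    (\<exists>t\<in>T. y i t < y k t \<and> (\<forall>u\<in>T. t \<le> u \<longrightarrow> y j u < y k u))"
proof -
  obtain t where t: "t \<in> T" "y i t < y k t" "y j t < y k t"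
    using assms unfolding admissible_def by (metis less_irrefl)
  have "is_interval {t \<in> T. y k t \<le> y j t}"
    using assms unfolding admissible_def before_def by (simp add: is_interval_convex_1)
  then have "\<not> (u \<in> T \<and> y k u \<le> y j u \<and> u \<le> t \<and> v \<in> T \<and> y k v \<le> y j v \<and> t \<le> v)" for u v
    using t unfolding is_interval_1 by (smt (verit) mem_Collect_eq)
  then show ?thesis using t by (meson not_le)
qed

section \<open>Reflection of the line, and long uniform chains from Ramsey's theorem\<close>

abbreviation reflect :: "('a \<Rightarrow> real \<Rightarrow> real) \<Rightarrow> 'a \<Rightarrow> real \<Rightarrow> real" where
  "reflect y \<equiv> \<lambda>i t. y i (- t)"

lemma before_reflect:
  assumes "before T a b"
  shows "before (uminus ` T) (\<lambda>t. a (- t)) (\<lambda>t. b (- t))"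
proof -
  have "{t \<in> uminus ` T. a (- t) < b (- t)} = uminus ` {t \<in> T. a t < b t}"
    "{t \<in> uminus ` T. a (- t) \<le> b (- t)} = uminus ` {t \<in> T. a t \<le> b t}" by auto
  then show ?thesis using assms unfolding before_def by (simp add: convex_negations)
qed

lemma admissible_reflect:
  assumes "admissible T H y"
  shows "admissible (uminus ` T) H (reflect y)"
  using assms before_reflect unfolding admissible_def by (simp add: bex_simps(7))

text \<open>Ramsey's theorem is applied twice: first to the side given by
  \<open>left_or_right\<close>, then to the order of two functions at a later witness. If the left
  alternative fails throughout, the right one holds throughout, and reflection turns it into the
  left one.\<close>

lemma uniform_chain_exists:
  "\<exists>K. \<forall>T y. convex T \<and> admissible T {..<K} y \<longrightarrow>
    (\<exists>H b w. H \<subseteq> {..<K} \<and> card H = M \<and>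
      (uniform_chain T b H y w \<or> uniform_chain (uminus ` T) b H (reflect y) w))"
proof -
  obtain N where N: "\<forall>S::nat set. \<forall>col :: nat \<Rightarrow> nat \<Rightarrow> nat \<Rightarrow> bool. finite S \<and> N \<le> card S \<longrightarrow>
    (\<exists>H b. H \<subseteq> S \<and> card H = M \<and> (\<forall>i\<in>H. \<forall>j\<in>H. \<forall>k\<in>H. i < j \<longrightarrow> j < k \<longrightarrow> col i j k = b))"
    using Ramsey_increasing_triples[of M] by (rule exE)
  \<comment> \<open>The size is \<open>Suc N\<close> because \<open>chain_exists\<close> gives up
    the least index.\<close>
  obtain K where K: "\<forall>S::nat set. \<forall>col :: nat \<Rightarrow> nat \<Rightarrow> nat \<Rightarrow> bool. finite S \<and> K \<le> card S \<longrightarrow>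
    (\<exists>H b. H \<subseteq> S \<and> card H = Suc N \<and> (\<forall>i\<in>H. \<forall>j\<in>H. \<forall>k\<in>H. i < j \<longrightarrow> j < k \<longrightarrow> col i j k = b))"
    using Ramsey_increasing_triples[of "Suc N"] by (rule exE)
  have step: "\<exists>H' b w. H' \<subseteq> H \<and> card H' = M \<and> uniform_chain T b H' y w"
    if T: "convex T" and H: "finite H" "card H = Suc N" and adm: "admissible T H y"
      and left: "\<And>i k j. i \<in> H \<Longrightarrow> k \<in> H \<Longrightarrow> j \<in> H \<Longrightarrow> i < k \<Longrightarrow> k < j \<Longrightarrow>
        \<exists>t\<in>T. y i t < y k t \<and> (\<forall>u\<in>T. u \<le> t \<longrightarrow> y j u < y k u)"
    for T :: "real set" and H y
  proof -
    obtain w where w: "chain T (H - {Min H}) y w"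
      using chain_exists[OF T H(1) adm left] by blast
    have large: "finite (H - {Min H}) \<and> N \<le> card (H - {Min H})" using H Min_in[of H] by (cases "H = {}") auto
    from N[rule_format, OF large, of "\<lambda>i j k. y i (w k) < y j (w k)"]
    obtain H' b where H': "H' \<subseteq> H - {Min H}" "card H' = M"
      "\<forall>i\<in>H'. \<forall>j\<in>H'. \<forall>k\<in>H'. i < j \<longrightarrow> j < k \<longrightarrow> (y i (w k) < y j (w k)) = b"
      by (elim exE conjE) (rule that)
    then have "uniform_chain T b H' y w"
      unfolding uniform_chain_def using chain_subset[OF w H'(1)] by simp
    moreover have "H' \<subseteq> H" using H'(1) by blast
    ultimately show ?thesis using H'(2) by (intro exI conjI)
  qed
  show ?thesis
  proof (rule exI[of _ K], intro allI impI, elim conjE)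
    fix T :: "real set" and y assume T: "convex T" and adm: "admissible T {..<K} y"
    have "finite {..<K} \<and> K \<le> card {..<K}" by simp
    from K[rule_format, OF this, of "\<lambda>i k j. \<exists>t\<in>T. y i t < y k t \<and> (\<forall>u\<in>T. u \<le> t \<longrightarrow> y j u < y k u)"]
    obtain H b where H: "H \<subseteq> {..<K}" "card H = Suc N" and
      col: "\<forall>i\<in>H. \<forall>k\<in>H. \<forall>j\<in>H. i < k \<longrightarrow> k < j \<longrightarrow>
        (\<exists>t\<in>T. y i t < y k t \<and> (\<forall>u\<in>T. u \<le> t \<longrightarrow> y j u < y k u)) = b"
      by (elim exE conjE) (rule that)
    have fin: "finite H" using H finite_subset by blast
    have admH: "admissible T H y" using adm H admissible_subset by blast
    have "\<exists>H' b' w. H' \<subseteq> H \<and> card H' = M \<and>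
      (uniform_chain T b' H' y w \<or> uniform_chain (uminus ` T) b' H' (reflect y) w)"
    proof (cases b)
      case True
      then show ?thesis using step[OF T fin H(2) admH] col by blast
    next
      case False
      have "convex (uminus ` T)" using T by (rule convex_negations)
      moreover have "\<exists>t\<in>uminus ` T. y i (- t) < y k (- t) \<and> (\<forall>u\<in>uminus ` T. u \<le> t \<longrightarrow> y j (- u) < y k (- u))"
        if "i \<in> H" "k \<in> H" "j \<in> H" "i < k" "k < j" for i k j
        using left_or_right[OF admH that] col that False by (simp add: bex_simps(7))
      ultimately show ?thesis
        using step[OF _ fin H(2) admissible_reflect[OF admH]] by blast
    qed
    then obtain H' b' w where H': "H' \<subseteq> H" "card H' = M"
      "uniform_chain T b' H' y w \<or> uniform_chain (uminus ` T) b' H' (reflect y) w"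
      by (elim exE conjE) (rule that)
    have "H' \<subseteq> {..<K}" using H'(1) H(1) by (rule subset_trans)
    then show "\<exists>H b w. H \<subseteq> {..<K} \<and> card H = M \<and>
      (uniform_chain T b H y w \<or> uniform_chain (uminus ` T) b H (reflect y) w)"
      using H'(2,3) by (intro exI[of _ H'] exI[of _ b'] exI[of _ w] conjI)
  qed
qed

section \<open>Comparing the witnesses of different chains\<close>

lemma chain_in: "chain T H y w \<Longrightarrow> k \<in> H \<Longrightarrow> w k \<in> T"
  unfolding chain_def by blast

lemma chain_above_later:
  "chain T H y w \<Longrightarrow> k \<in> H \<Longrightarrow> j \<in> H \<Longrightarrow> k < j \<Longrightarrow> t \<in> T \<Longrightarrow> t \<le> w k \<Longrightarrow> y j t < y k t"
  unfolding chain_def by blast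

text \<open>Up to \<open>w' p'\<close> the function at \<open>p'\<close> stays above the one at
  \<open>p\<close>, while at \<open>w p\<close> the order is reversed. So two shared functions order
  the witnesses even across chains that differ elsewhere.\<close>

lemma chain_interleave:
  assumes c: "chain T H y w" and c': "chain T H' y' w'"
    and H: "p' \<in> H" "p \<in> H" "p' \<in> H'" "p \<in> H'" "p' < p"
    and eq: "y' p' = y p'" "y' p = y p"
  shows "w' p' < w p"
proof (rule ccontr)
  assume "\<not> w' p' < w p"
  then have "y' p (w p) < y' p' (w p)"
    using chain_above_later[OF c' H(3,4,5) chain_in[OF c H(2)]] by simp
  moreover have "y p' (w p) < y p (w p)"
    using chain_top[OF c H(2,1)] H(5) by simp
  ultimately show False using eq by simp
qed

lemma chain_mono: "chain T H y w \<Longrightarrow> p' \<in> H \<Longrightarrow> p \<in> H \<Longrightarrow> p' < p \<Longrightarrow> w p' < w p"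
  using chain_interleave[of T H y w H y w p' p] by simp

lemma uniform_chain_less:
  "uniform_chain T b H y w \<Longrightarrow> i \<in> H \<Longrightarrow> j \<in> H \<Longrightarrow> k \<in> H \<Longrightarrow> i < j \<Longrightarrow> j < k \<Longrightarrow>
    (y i (w k) < y j (w k)) = b"
  unfolding uniform_chain_def by blast

text \<open>At the witness \<open>w x\<close> some fixed function with index in \<open>P\<close> lies below \<open>y x\<close> and above \<open>y' x'\<close>:
  a place between \<open>x\<close> and \<open>x'\<close> if \<open>x < x'\<close> or \<open>b\<close> holds, and a place before \<open>x'\<close> otherwise.\<close>

lemma chain_exchange:
  assumes c: "uniform_chain T b (insert x P) y w" and c': "uniform_chain T b (insert x' P) y' w'"
    and eq: "\<And>p. p \<in> P \<Longrightarrow> y' p = y p" and "x \<notin> P" "x' \<notin> P"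
    and bef: "\<And>i j. i \<in> insert x' P \<Longrightarrow> j \<in> insert x' P \<Longrightarrow> i < j \<Longrightarrow> before T (y' i) (y' j)"
    and up: "x < x' \<Longrightarrow> \<exists>p\<in>P. \<exists>p'\<in>P. x < p \<and> p < p' \<and> p' < x'"
    and down: "x' < x \<Longrightarrow> \<exists>a\<in>P. \<exists>p'\<in>P. \<exists>p\<in>P. \<exists>q\<in>P. \<exists>q'\<in>P. a < x' \<and> x' < p' \<and> p' < p \<and> p < x \<and> x < q \<and> q < q'"
    and "x \<noteq> x'"
  shows "y' x' (w x) < y x (w x)"
proof -
  have ch: "chain T (insert x P) y w" and ch': "chain T (insert x' P) y' w'"
    using c c' by (auto simp: uniform_chain_def)
  have wT: "w x \<in> T" by (rule chain_in[OF ch]) simp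
  have wT': "w' p \<in> T" if "p \<in> insert x' P" for p by (rule chain_in[OF ch' that])
  have top: "y p (w x) < y x (w x)" if "p \<in> P" for p
    using chain_top[OF ch, of x p] that \<open>x \<notin> P\<close> by auto
  have inter: "w' p' < w p" "w p' < w' p" if "p' \<in> P" "p \<in> P" "p' < p" for p' p
    using chain_interleave[OF ch ch', of p' p] chain_interleave[OF ch' ch, of p' p] that eq by auto
  show ?thesis
  proof (cases "x < x'")
    case True
    then obtain p p' where p: "p \<in> P" "p' \<in> P" "x < p" "p < p'" "p' < x'" using up by blast
    \<comment> \<open>The point \<open>w x\<close> lies to the left of \<open>w' p'\<close>, where
      in the second chain \<open>p'\<close> still dominates the later \<open>x'\<close>.\<close>
    have "w x < w p" using chain_mono[OF ch] p by auto
    also have "\<dots> < w' p'" using inter p by auto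
    finally have "y' x' (w x) < y' p' (w x)"
      using chain_above_later[OF ch', of p' x' "w x"] p wT by simp
    then show ?thesis using top[of p'] eq p by auto
  next
    case False
    then obtain a p' p q q' where p: "a \<in> P" "p' \<in> P" "p \<in> P" "q \<in> P" "q' \<in> P"
        "a < x'" "x' < p'" "p' < p" "p < x" "x < q" "q < q'"
      using down \<open>x \<noteq> x'\<close> by auto
    have "w' p' < w p" using inter p by auto
    also have "\<dots> < w x" using chain_mono[OF ch] p by auto
    finally have lo: "w' p' < w x" .
    have "w x < w q" using chain_mono[OF ch] p by auto
    also have "\<dots> < w' q'" using inter p by auto
    finally have hi: "w x < w' q'" .
    show ?thesis
    proof (cases b)
      case True
      \<comment> \<open>With \<open>b\<close> true, \<open>x'\<close> is below \<open>p'\<close> at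
        the witnesses of \<open>p'\<close> and of \<open>q'\<close>, hence on the interval between
        them, which contains \<open>w x\<close>.\<close>
      have "y' x' (w' p') < y' p' (w' p')"
        using chain_top[OF ch', of p' x'] p \<open>x' \<notin> P\<close> by auto
      moreover have "y' x' (w' q') < y' p' (w' q')"
        using uniform_chain_less[OF c', of x' p' q'] True p by simp
      moreover have "is_interval {t \<in> T. y' x' t < y' p' t}"
        using bef[of x' p'] p by (simp add: before_def is_interval_convex_1)
      ultimately have "y' x' (w x) < y' p' (w x)"
        using mem_is_interval_1_I[of "{t \<in> T. y' x' t < y' p' t}" "w' p'" "w' q'" "w x"]
          wT'[of p'] wT'[of q'] p lo hi by simp
      then show ?thesis using top[of p'] eq p by auto
    next
      case False
      \<comment> \<open>With \<open>b\<close> false, \<open>x'\<close> exceeds \<open>a\<close> at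
        its own witness but no longer at \<open>w' p'\<close>. As it exceeds \<open>a\<close> on an
        interval, it does not do so again at \<open>w x\<close>, further right.\<close>
      have "y' a (w' x') < y' x' (w' x')"
        using chain_top[OF ch', of x' a] p \<open>x' \<notin> P\<close> by auto
      moreover have "\<not> y' a (w' p') < y' x' (w' p')"
        using uniform_chain_less[OF c', of a x' p'] False p by simp
      moreover have "is_interval {t \<in> T. y' a t < y' x' t}"
        using bef[of a x'] p by (simp add: before_def is_interval_convex_1)
      moreover have "w' x' < w' p'" using chain_mono[OF ch'] p by auto
      ultimately have "\<not> y' a (w x) < y' x' (w x)"
        using mem_is_interval_1_I[of "{t \<in> T. y' a t < y' x' t}" "w' x'" "w x" "w' p'"]
          wT'[of x'] wT'[of p'] wT p lo by auto
      then show ?thesis using top[of a] eq p by auto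
    qed
  qed
qed

section \<open>Height functions of bodies\<close>

definition support :: "'a::euclidean_space set \<Rightarrow> 'a \<Rightarrow> real" where
  "support A u = (SUP x\<in>A. x \<bullet> u)"

lemma support_attained:
  assumes "compact A" "A \<noteq> {}"
  obtains x where "x \<in> A" "x \<bullet> u = support A u"
proof -
  have "continuous_on A (\<lambda>x. x \<bullet> u)" by (intro continuous_intros)
  from continuous_attains_sup[OF assms this]
  obtain x where x: "x \<in> A" "\<forall>y\<in>A. y \<bullet> u \<le> x \<bullet> u" by blast
  then have "support A u = x \<bullet> u"
    unfolding support_def by (intro cSup_eq_maximum) auto
  then show thesis using x that by simp
qed

lemma inner_le_support:
  assumes "compact A" "x \<in> A"
  shows "x \<bullet> u \<le> support A u"
proof -
  have "compact ((\<lambda>x. x \<bullet> u) ` A)"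
    using assms(1) by (intro compact_continuous_image continuous_intros)
  then show ?thesis
    unfolding support_def using assms(2)
    by (intro cSUP_upper compact_imp_bounded bounded_imp_bdd_above)
qed

lemma support_scaleR:
  assumes "compact A" "A \<noteq> {}" "0 < c"
  shows "support A (c *\<^sub>R u) = c * support A u"
proof -
  obtain x where x: "x \<in> A" "x \<bullet> u = support A u" using support_attained assms by blast
  obtain z where z: "z \<in> A" "z \<bullet> (c *\<^sub>R u) = support A (c *\<^sub>R u)" using support_attained assms by blast
  have "c * (x \<bullet> u) \<le> support A (c *\<^sub>R u)" using inner_le_support[OF assms(1) x(1), of "c *\<^sub>R u"] by simp
  moreover have "c * (z \<bullet> u) \<le> c * support A u"
    using inner_le_support[OF assms(1) z(1), of u] assms(3) by simp
  ultimately show ?thesis using x z by simp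
qed

lemma support_zero: "A \<noteq> {} \<Longrightarrow> support A 0 = 0"
  by (simp add: support_def)

text \<open>The support function is a maximum of linear functions, hence convex, and this is a
  strict sublevel set of its difference with a linear function. A maximiser for the combined
  direction reduces the inequality to the linear case.\<close>

lemma convex_support_less:
  assumes "compact B" "B \<noteq> {}"
  shows "convex {u. support B u < x \<bullet> u}"
proof (rule convexI)
  fix u v and s t :: real
  assume uv: "u \<in> {u. support B u < x \<bullet> u}" "v \<in> {u. support B u < x \<bullet> u}"
    and st: "0 \<le> s" "0 \<le> t" "s + t = 1"
  obtain b where b: "b \<in> B" "b \<bullet> (s *\<^sub>R u + t *\<^sub>R v) = support B (s *\<^sub>R u + t *\<^sub>R v)"
    using support_attained assms by blast
  have lt: "b \<bullet> u < x \<bullet> u" "b \<bullet> v < x \<bullet> v"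
    using inner_le_support[OF assms(1) b(1)] uv by (auto intro: le_less_trans)
  have "s * (b \<bullet> u) + t * (b \<bullet> v) < s * (x \<bullet> u) + t * (x \<bullet> v)"
  proof (cases "s = 0")
    case True
    then show ?thesis using lt st by simp
  next
    case False
    then show ?thesis using lt st by (intro add_less_le_mono mult_left_mono mult_strict_left_mono) auto
  qed
  then show "s *\<^sub>R u + t *\<^sub>R v \<in> {u. support B u < x \<bullet> u}"
    using b(2) by (simp add: inner_add_right)
qed

lemma support_separates:
  assumes "convex B" "compact B" "B \<noteq> {}" "x \<notin> B"
  obtains u where "support B u < x \<bullet> u"
proof -
  obtain a c where ac: "a \<bullet> x < c" "\<forall>b\<in>B. a \<bullet> b > c"
    using separating_hyperplane_closed_point[of B x] assms compact_imp_closed by blast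
  obtain b where b: "b \<in> B" "b \<bullet> (- a) = support B (- a)" using support_attained assms by blast
  have "support B (- a) < x \<bullet> (- a)"
    using ac b by (auto simp: inner_commute simp flip: b(2))
  then show thesis by (rule that)
qed

text \<open>The set below is the union over \<open>x \<in> A - B\<close> of the convex cones \<open>{u. support B u < x \<bullet> u}\<close>;
  these are nonempty and cones of nearby points overlap.\<close>

lemma connected_support_less:
  assumes A: "compact A" "A \<noteq> {}" and B: "compact B" "convex B" "B \<noteq> {}" and conn: "connected (A - B)"
  shows "connected {u. support B u < support A u}"
proof -
  define Q where "Q = {u. support B u < support A u}"
  define D where "D x = {u. support B u < x \<bullet> u}" for x
  have DQ: "D x \<subseteq> Q" if "x \<in> A" for x
    using inner_le_support[OF A(1) that] by (auto simp: D_def Q_def intro: less_le_trans)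
  have QD: "\<exists>x\<in>A - B. u \<in> D x" if "u \<in> Q" for u
  proof -
    obtain x where x: "x \<in> A" "x \<bullet> u = support A u" using support_attained A by blast
    moreover have "x \<notin> B" using inner_le_support[OF B(1), of x u] that x(2) by (auto simp: Q_def)
    moreover have "u \<in> D x" using that x(2) by (simp add: D_def Q_def)
    ultimately show ?thesis by blast
  qed
  have connD: "connected (D x)" for x
    unfolding D_def using convex_support_less[OF B(1,3)] by (rule convex_connected)
  have neD: "D x \<noteq> {}" if "x \<notin> B" for x
    using support_separates[OF B(2,1,3) that] by (auto simp: D_def)
  \<comment> \<open>Points are related if their cones lie in one component of \<open>Q\<close>.
    Connectedness of \<open>A - B\<close> spreads this relation from neighbourhoods to the whole
    set.\<close>
  define R where "R x y \<longleftrightarrow> (\<forall>u\<in>D x. \<forall>v\<in>D y. connected_component Q u v)" for x y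
  have all: "R x y" if "x \<in> A - B" "y \<in> A - B" for x y
  proof (rule connected_equivalence_relation[OF conn that])
    show "R y x" if "R x y" for x y using that connected_component_sym unfolding R_def by blast
    show "R x z" if "R x y" "R y z" "y \<in> A - B" for x y z
    proof -
      obtain v where "v \<in> D y" using neD \<open>y \<in> A - B\<close> by blast
      then show ?thesis using that(1,2) connected_component_trans unfolding R_def by blast
    qed
    fix x assume x: "x \<in> A - B"
    then obtain u where u: "u \<in> D x" using neD by blast
    \<comment> \<open>For every \<open>z\<close> in this neighbourhood of \<open>x\<close> the cone
      of \<open>z\<close> contains \<open>u\<close> too, so the cones of \<open>x\<close> and
      \<open>z\<close> overlap.\<close>
    define U where "U = {z. support B u < z \<bullet> u}"
    have "open U"
      unfolding U_def by (intro open_Collect_less continuous_intros)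
    then have "openin (top_of_set (A - B)) ((A - B) \<inter> U)" by (rule openin_open_Int)
    moreover have "x \<in> (A - B) \<inter> U" using x u by (auto simp: D_def U_def)
    moreover have "R x z" if z: "z \<in> (A - B) \<inter> U" for z
      unfolding R_def
    proof (intro ballI)
      fix v v' assume v: "v \<in> D x" "v' \<in> D z"
      have "u \<in> D z" using z by (simp add: D_def U_def)
      have "connected_component Q v u"
        using connD[of x] DQ[of x] x v(1) u by (intro connected_componentI[of "D x"]) auto
      moreover have "connected_component Q u v'"
        using connD[of z] DQ[of z] z v(2) \<open>u \<in> D z\<close> by (intro connected_componentI[of "D z"]) auto
      ultimately show "connected_component Q v v'" by (rule connected_component_trans)
    qed
    ultimately show "\<exists>T. openin (top_of_set (A - B)) T \<and> x \<in> T \<and> (\<forall>y\<in>T. R x y)" by blast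
  qed
  have "connected Q"
    unfolding connected_iff_connected_component
  proof (intro ballI)
    fix u v assume "u \<in> Q" "v \<in> Q"
    then obtain x y where "x \<in> A - B" "u \<in> D x" "y \<in> A - B" "v \<in> D y" using QD by meson
    then show "connected_component Q u v" using all[of x y] unfolding R_def by blast
  qed
  then show ?thesis by (simp add: Q_def)
qed

section \<open>Directions given by angles, and cones of directions\<close>

definition direction :: "real \<Rightarrow> real^2" where
  "direction t = vector [cos t, sin t]"

text \<open>The passage to complex numbers gives access to \<open>Arg2pi\<close> and its
  continuity.\<close>

definition to_complex :: "real^2 \<Rightarrow> complex" where
  "to_complex v = Complex (v $ 1) (v $ 2)"

lemma to_complex_scaleR_direction: "to_complex (r *\<^sub>R direction t) = of_real r * cis t"
  by (simp add: to_complex_def direction_def complex_eq_iff)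

lemma to_complex_inject: "to_complex u = to_complex v \<longleftrightarrow> u = v"
  by (auto simp: to_complex_def vec_eq_iff forall_2)

lemma continuous_to_complex [continuous_intros]:
  "continuous_on S to_complex"
proof -
  have eq: "to_complex = (\<lambda>v. of_real (v $ 1) + \<i> * of_real (v $ 2))"
    by (auto simp: to_complex_def complex_eq_iff)
  show ?thesis unfolding eq by (intro continuous_intros)
qed

lemma direction_polar:
  obtains r t where "0 \<le> t" "t < 2 * pi" "0 \<le> r" "u = r *\<^sub>R direction t"
proof
  show "0 \<le> Arg2pi (to_complex u)" "Arg2pi (to_complex u) < 2 * pi"
    using Arg2pi by blast+
  show "u = cmod (to_complex u) *\<^sub>R direction (Arg2pi (to_complex u))"
    unfolding to_complex_inject[symmetric] to_complex_scaleR_direction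
    using Arg2pi_eq[of "to_complex u"] by (simp add: cis_conv_exp)
qed simp

lemma direction_periodic: "direction (t + 2 * pi) = direction t"
  by (simp add: direction_def)

text \<open>As \<open>Q\<close> misses the ray at angle \<open>a\<close>, the angle measured from
  \<open>a\<close> is continuous on \<open>Q\<close>. Its image is connected and contains
  \<open>b - a\<close> and \<open>d - a\<close>, hence \<open>c - a\<close>; but the cone
  \<open>Q\<close> misses the ray at angle \<open>c\<close> as well.\<close>

lemma connected_cone_no_alternation:
  assumes conn: "connected Q" and cone: "\<And>r u. 0 < r \<Longrightarrow> r *\<^sub>R u \<in> Q \<Longrightarrow> u \<in> Q" and "0 \<notin> Q"
    and abcd: "a < b" "b < c" "c < d" "d < a + 2 * pi"
    and Q: "direction a \<notin> Q" "direction b \<in> Q" "direction c \<notin> Q" "direction d \<in> Q"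
  shows False
proof -
  have notQ: "r *\<^sub>R direction t \<notin> Q" if "0 \<le> r" "direction t \<notin> Q" for r t
    using cone[of r "direction t"] that \<open>0 \<notin> Q\<close> by (cases "r = 0") auto
  \<comment> \<open>Rotation by \<open>- a\<close> moves the missing ray onto the nonnegative reals,
    off which \<open>Arg2pi\<close> is continuous.\<close>
  define \<phi> where "\<phi> u = Arg2pi (to_complex u * cis (- a))" for u
  have rot: "to_complex u = z * cis t" if "to_complex u * cis (- a) = z * cis (t - a)" for u z t
  proof -
    have "to_complex u = to_complex u * cis (- a) * cis a" by (simp add: cis_mult mult.assoc)
    also have "\<dots> = z * cis t" unfolding that by (simp add: cis_mult mult.assoc)
    finally show ?thesis .
  qed
  have avoid: "to_complex u * cis (- a) \<in> - \<real>\<^sub>\<ge>\<^sub>0" if "u \<in> Q" for u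
  proof
    assume nn: "to_complex u * cis (- a) \<in> \<real>\<^sub>\<ge>\<^sub>0"
    define r where "r = Re (to_complex u * cis (- a))"
    have r: "0 \<le> r" "to_complex u * cis (- a) = of_real r * cis (a - a)"
      using nn unfolding r_def complex_nonneg_Reals_iff by (simp_all add: complex_eq_iff)
    have "u = r *\<^sub>R direction a"
      unfolding to_complex_inject[symmetric] to_complex_scaleR_direction by (rule rot[OF r(2)])
    then show False using notQ[OF \<open>0 \<le> r\<close> Q(1)] that by simp
  qed
  have Arg: "continuous_on (- \<real>\<^sub>\<ge>\<^sub>0) Arg2pi"
    by (intro continuous_at_imp_continuous_on ballI continuous_at_Arg2pi) simp
  have lin: "continuous_on Q (\<lambda>u. to_complex u * cis (- a))" by (intro continuous_intros)
  have "continuous_on Q \<phi>"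
    unfolding \<phi>_def by (rule continuous_on_compose2[OF Arg lin]) (use avoid in blast)
  then have im: "connected (\<phi> ` Q)" using conn by (rule connected_continuous_image)
  have \<phi>_dir: "\<phi> (direction t) = t - a" if "a \<le> t" "t < a + 2 * pi" for t
    unfolding \<phi>_def
  proof (rule Arg2pi_unique)
    show "of_real 1 * exp (\<i> * of_real (t - a)) = to_complex (direction t) * cis (- a)"
      using to_complex_scaleR_direction[of 1 t] unfolding cis_conv_exp[symmetric] by (simp add: cis_mult)
  qed (use that in auto)
  have "\<phi> (direction b) = b - a" "\<phi> (direction d) = d - a"
    using abcd by (simp_all add: \<phi>_dir)
  then have "b - a \<in> \<phi> ` Q" "d - a \<in> \<phi> ` Q"
    using Q(2,4) by (metis imageI)+
  then have "c - a \<in> \<phi> ` Q"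
    using connectedD_interval[OF im, of "b - a" "d - a" "c - a"] abcd by simp
  then obtain u where u: "u \<in> Q" "\<phi> u = c - a" by force
  define w where "w = to_complex u * cis (- a)"
  have "Arg2pi w = c - a" using u(2) by (simp add: \<phi>_def w_def)
  then have "w = of_real (cmod w) * cis (c - a)"
    using Arg2pi_eq[of w] by (simp add: cis_conv_exp)
  then have "u = cmod w *\<^sub>R direction c"
    unfolding to_complex_inject[symmetric] to_complex_scaleR_direction w_def by (rule rot)
  then show False using notQ[OF norm_ge_zero Q(3), of w] u(1) by simp
qed

section \<open>Comparing two bodies by their heights\<close>

definition height :: "(real^2) set \<Rightarrow> real \<Rightarrow> real" where
  "height A t = support A (direction t)"

lemma height_periodic: "height A (t + 2 * pi) = height A t"
  by (simp add: height_def direction_periodic)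

text \<open>This expresses, without mentioning arcs, that the directions in which \<open>A\<close>
  is higher than \<open>B\<close> form an arc: the comparison cannot alternate four times within one
  turn.\<close>

lemma height_no_alternation:
  assumes "body A" "body B" "connected (A - B)"
    and abcd: "a < b" "b < c" "c < d" "d < a + 2 * pi"
    and "height A a \<le> height B a" "height B b < height A b"
      "height A c \<le> height B c" "height B d < height A d"
  shows False
proof (rule connected_cone_no_alternation[OF _ _ _ abcd])
  have A: "compact A" "A \<noteq> {}" and B: "compact B" "convex B" "B \<noteq> {}"
    using assms by (auto simp: body_def)
  show "connected {u. support B u < support A u}"
    using connected_support_less[OF A B assms(3)] .
  show "u \<in> {u. support B u < support A u}"
    if "0 < r" "r *\<^sub>R u \<in> {u. support B u < support A u}" for r u
    using that by (simp add: support_scaleR A B)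
qed (use assms in \<open>auto simp: height_def body_def support_zero\<close>)

text \<open>A gap between two points where \<open>B\<close> is higher would alternate together with
  the cut \<open>0\<close>. A tie at \<open>0\<close> is enough for this, so the lemma also serves
  the bodies tied there.\<close>

lemma convex_height_less:
  assumes "body A" "body B" "connected (B - A)" and "height B 0 \<le> height A 0"
  shows "convex {t \<in> {0<..<2 * pi}. height A t < height B t}"
  unfolding is_interval_convex_1[symmetric] is_interval_1
proof (intro ballI allI impI)
  fix a b x
  assume a: "a \<in> {t \<in> {0<..<2 * pi}. height A t < height B t}"
    and b: "b \<in> {t \<in> {0<..<2 * pi}. height A t < height B t}" and x: "a \<le> x \<and> x \<le> b"
  have "height A x < height B x"
  proof (rule ccontr)
    assume neg: "\<not> height A x < height B x"
    then have "a < x" "x < b" using a b x by (auto simp: order_less_le)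
    then show False
      using height_no_alternation[OF assms(2,1,3), of 0 a x b] a b neg assms(4) by auto
  qed
  then show "x \<in> {t \<in> {0<..<2 * pi}. height A t < height B t}" using a b x by auto
qed

lemma before_height:
  assumes "body A" "body B" "connected (A - B)" "connected (B - A)" and "height B 0 < height A 0"
  shows "before {0<..<2 * pi} (height A) (height B)"
  unfolding before_def
proof
  show "convex {t \<in> {0<..<2 * pi}. height A t < height B t}"
    using assms by (intro convex_height_less) auto
  show "convex {t \<in> {0<..<2 * pi}. height A t \<le> height B t}"
    unfolding is_interval_convex_1[symmetric] is_interval_1
  proof (intro ballI allI impI)
    fix a b x
    assume a: "a \<in> {t \<in> {0<..<2 * pi}. height A t \<le> height B t}"
      and b: "b \<in> {t \<in> {0<..<2 * pi}. height A t \<le> height B t}" and x: "a \<le> x \<and> x \<le> b"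
    have "height A x \<le> height B x"
    proof (rule ccontr)
      assume neg: "\<not> height A x \<le> height B x"
      then have "a < x" "x < b" using a b x by (auto simp: order_less_le)
      \<comment> \<open>For the weak inequality the cut is the last point of the alternation, seen
        as \<open>2 * pi\<close>, and \<open>A\<close> must be strictly higher there.\<close>
      moreover have "height A (2 * pi) = height A 0" "height B (2 * pi) = height B 0"
        using height_periodic[of _ 0] by simp_all
      ultimately show False
        using height_no_alternation[OF assms(1,2,3), of a x b "2 * pi"] a b neg assms(5) by auto
    qed
    then show "x \<in> {t \<in> {0<..<2 * pi}. height A t \<le> height B t}" using a b x by auto
  qed
qed

text \<open>In a direction where \<open>K\<close> is strictly highest, an open half-plane contains
  all other members, hence their hull, but not a highest point of \<open>K\<close>.\<close>

lemma convexly_independentI: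
  assumes "\<And>K. K \<in> \<F> \<Longrightarrow> body K"
    and "\<And>K. K \<in> \<F> \<Longrightarrow> \<exists>t. \<forall>L\<in>\<F> - {K}. height L t < height K t"
  shows "convexly_independent \<F>"
  unfolding convexly_independent_def
proof
  fix K assume K: "K \<in> \<F>"
  then obtain t where t: "\<forall>L\<in>\<F> - {K}. height L t < height K t" using assms(2) by blast
  have "compact K" "K \<noteq> {}" using assms(1) K by (auto simp: body_def)
  then obtain x where x: "x \<in> K" "x \<bullet> direction t = height K t"
    unfolding height_def using support_attained by blast
  have "convex {z. z \<bullet> direction t < height K t}"
    unfolding inner_commute[of _ "direction t"] by (rule convex_halfspace_lt)
  moreover have "\<Union>(\<F> - {K}) \<subseteq> {z. z \<bullet> direction t < height K t}"
  proof
    fix z assume "z \<in> \<Union>(\<F> - {K})"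
    then obtain L where L: "z \<in> L" "L \<in> \<F> - {K}" by blast
    then have "z \<bullet> direction t \<le> height L t"
      unfolding height_def using assms(1) by (intro inner_le_support) (auto simp: body_def)
    also have "\<dots> < height K t" using t L by blast
    finally show "z \<in> {z. z \<bullet> direction t < height K t}" by simp
  qed
  ultimately have "convex hull \<Union>(\<F> - {K}) \<subseteq> {z. z \<bullet> direction t < height K t}"
    by (rule hull_minimal[rotated])
  then show "\<not> K \<subseteq> convex hull \<Union>(\<F> - {K})" using x by auto
qed

text \<open>The hull of the other members is compact, so a point of \<open>K\<close> outside it is
  strictly separated from it. The normal of the separating line, scaled to a unit vector, is the
  direction wanted.\<close>

lemma convexly_independent_height:
  assumes "finite \<F>" "\<And>K. K \<in> \<F> \<Longrightarrow> body K" "convexly_independent \<F>" "K \<in> \<F>" "\<F> - {K} \<noteq> {}"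
  obtains t where "0 \<le> t" "t < 2 * pi" "\<And>L. L \<in> \<F> - {K} \<Longrightarrow> height L t < height K t"
proof -
  define C where "C = convex hull \<Union>(\<F> - {K})"
  have sub: "L \<subseteq> C" if "L \<in> \<F> - {K}" for L
    unfolding C_def using that by (meson Union_upper hull_subset order_trans)
  have K: "compact K" "K \<noteq> {}" using assms(2,4) by (auto simp: body_def)
  have "compact (\<Union>(\<F> - {K}))" using assms(1,2) by (intro compact_Union) (auto simp: body_def)
  then have "compact C" unfolding C_def by (rule compact_convex_hull)
  have "C \<noteq> {}" using sub assms(2,5) by (fastforce simp: body_def)
  obtain x where x: "x \<in> K" "x \<notin> C"
    using assms(3,4) unfolding convexly_independent_def C_def by blast
  obtain u where u: "support C u < x \<bullet> u"
    using support_separates[of C x] \<open>compact C\<close> \<open>C \<noteq> {}\<close> x(2) unfolding C_def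
    by (metis convex_convex_hull)
  have less: "support L u < support K u" if "L \<in> \<F> - {K}" for L
  proof -
    have L: "compact L" "L \<noteq> {}" using assms(2) that by (auto simp: body_def)
    obtain z where z: "z \<in> L" "z \<bullet> u = support L u" using support_attained[OF L] by blast
    then have "support L u \<le> support C u"
      using inner_le_support[OF \<open>compact C\<close>, of z u] sub[OF that] by auto
    also have "\<dots> < x \<bullet> u" by (rule u)
    also have "\<dots> \<le> support K u" by (rule inner_le_support[OF K(1) x(1)])
    finally show ?thesis .
  qed
  obtain r t where rt: "0 \<le> t" "t < 2 * pi" "0 \<le> r" "u = r *\<^sub>R direction t"
    by (rule direction_polar)
  have "r \<noteq> 0" using u rt(4) support_zero[OF \<open>C \<noteq> {}\<close>] by auto
  then have "0 < r" using rt(3) by simp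
  have "height L t < height K t" if "L \<in> \<F> - {K}" for L
  proof -
    have "compact L" "L \<noteq> {}" using assms(2) that by (auto simp: body_def)
    then show ?thesis
      using less[OF that] \<open>0 < r\<close> K unfolding rt(4) height_def by (simp add: support_scaleR)
  qed
  then show thesis using that rt by blast
qed

section \<open>Clusterings\<close>

text \<open>Some colour \<open>t\<close> and some frozen values outside \<open>X t\<close> leave at
  least \<open>m ^ card (X t) / card \<T>\<close> transversals. These inject into the product of
  their projections, each of size at most \<open>m\<close>, so every single projection has size at
  least \<open>m / card \<T>\<close>.\<close>

lemma product_pigeonhole:
  fixes \<tau> :: "('i \<Rightarrow> 'a) \<Rightarrow> 't" and X :: "'t \<Rightarrow> 'i set"
  assumes I: "finite I" and G: "\<And>i. i \<in> I \<Longrightarrow> card (G i) = m" and "m > 0"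
    and \<T>: "finite \<T>" "\<T> \<noteq> {}" and \<tau>: "\<tau> \<in> PiE I G \<rightarrow> \<T>"
    and X: "\<And>t. t \<in> \<T> \<Longrightarrow> X t \<subseteq> I"
  shows "\<exists>t\<in>\<T>. \<exists>r. \<forall>x\<in>X t.
    m \<le> card \<T> * card {s x | s. s \<in> PiE I G \<and> \<tau> s = t \<and> (\<forall>i\<in>I - X t. s i = r i)}"
proof -
  have fin: "finite (G i)" if "i \<in> I" for i
    using G[OF that] \<open>m > 0\<close> by (metis card_gt_0_iff)
  have finPi: "finite (PiE J G)" if "J \<subseteq> I" for J
    using that fin I by (intro finite_PiE) (auto intro: finite_subset)
  have cardPi: "card (PiE J G) = m ^ card J" if "J \<subseteq> I" for J
  proof -
    have "card (PiE J G) = (\<Prod>i\<in>J. card (G i))" using that I finite_subset by (intro card_PiE) auto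
    also have "\<dots> = (\<Prod>i\<in>J. m)" using that G by (intro prod.cong) auto
    finally show ?thesis by simp
  qed
  obtain t where t: "t \<in> \<T>" and Dt: "card (PiE I G) \<le> card (\<tau> -` {t} \<inter> PiE I G) * card \<T>"
    using pigeonhole_card[OF \<tau> finPi \<T>] by blast
  define D where "D = \<tau> -` {t} \<inter> PiE I G"
  have finD: "finite D" using finPi[of I] by (simp add: D_def)
  have Xt: "X t \<subseteq> I" using X t by blast
  define J where "J = I - X t"
  have restr: "(\<lambda>s. restrict s J) \<in> D \<rightarrow> PiE J G" by (auto simp: D_def J_def)
  have nePi: "PiE J G \<noteq> {}"
    using cardPi[of J] \<open>m > 0\<close> by (metis Diff_subset J_def card.empty less_irrefl zero_less_power)
  \<comment> \<open>A second pigeonhole freezes the coordinates outside \<open>X t\<close>: at least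
    an average share of \<open>D\<close> has the same restriction.\<close>
  obtain r where r: "card D \<le> card ((\<lambda>s. restrict s J) -` {r} \<inter> D) * card (PiE J G)"
    using pigeonhole_card[OF restr finD finPi nePi] by (auto simp: J_def)
  define E where "E = (\<lambda>s. restrict s J) -` {r} \<inter> D"
  have finE: "finite E" using finD by (simp add: E_def)
  define S where "S x = {s x | s. s \<in> PiE I G \<and> \<tau> s = t \<and> (\<forall>i\<in>J. s i = r i)}" for x
  have ES: "s x \<in> S x" if "s \<in> E" for s x
    using that unfolding S_def E_def D_def by (auto intro!: exI[of _ s])
  have SG: "S x \<subseteq> G x" if "x \<in> I" for x
    using that by (auto simp: S_def)
  have split: "m ^ card I = m ^ card (X t) * m ^ card J"
    unfolding J_def using Xt I card_Diff_subset[of "X t" I] card_mono[of I "X t"] finite_subset[of "X t" I]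
    by (simp flip: power_add)
  have "m ^ card (X t) * m ^ card J \<le> card D * card \<T>"
    using Dt cardPi[of I] split by (simp add: D_def)
  also have "\<dots> \<le> card E * m ^ card J * card \<T>"
    using r cardPi[of J] by (intro mult_right_mono) (auto simp: E_def J_def)
  finally have bound: "m ^ card (X t) \<le> card E * card \<T>"
    using \<open>m > 0\<close> by (simp add: mult.assoc mult.commute[of "m ^ card J"])
  have "m \<le> card \<T> * card (S x)" if x: "x \<in> X t" for x
  proof -
    have finX: "finite (X t)" using Xt I finite_subset by blast
    have "inj_on (\<lambda>s. restrict s (X t)) E"
    proof (rule inj_onI)
      fix s s' assume s: "s \<in> E" "s' \<in> E" "restrict s (X t) = restrict s' (X t)"
      have "restrict s J = restrict s' J" using s(1,2) by (simp add: E_def)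
      show "s = s'"
      proof (rule PiE_ext)
        show "s \<in> PiE I G" "s' \<in> PiE I G" using s by (simp_all add: E_def D_def)
        fix i assume "i \<in> I"
        then show "s i = s' i"
          using s(3) \<open>restrict s J = restrict s' J\<close> unfolding J_def
          by (metis Diff_iff restrict_apply')
      qed
    qed
    moreover have "(\<lambda>s. restrict s (X t)) ` E \<subseteq> PiE (X t) S" using ES by auto
    moreover have finS: "finite (S i)" if "i \<in> X t" for i
      using SG fin that Xt by (meson finite_subset subsetD)
    ultimately have "card E \<le> card (PiE (X t) S)"
      using finX by (intro card_inj_on_le) (auto intro!: finite_PiE)
    also have "\<dots> = (\<Prod>i\<in>X t. card (S i))" by (rule card_PiE[OF finX])
    also have "\<dots> = card (S x) * (\<Prod>i\<in>X t - {x}. card (S i))" by (rule prod.remove[OF finX x])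
    \<comment> \<open>With all other factors bounded by \<open>m\<close>, the factor at
      \<open>x\<close> bears the whole loss.\<close>
    also have "\<dots> \<le> card (S x) * (\<Prod>i\<in>X t - {x}. m)"
    proof (intro mult_left_mono prod_mono)
      fix i assume "i \<in> X t - {x}"
      then have "i \<in> I" using Xt by blast
      then show "0 \<le> card (S i) \<and> card (S i) \<le> m"
        using card_mono[OF fin[of i] SG[of i]] G[of i] by simp
    qed simp
    finally have "card E \<le> card (S x) * m ^ (card (X t) - 1)"
      using finX x by simp
    moreover have "m ^ card (X t) = m * m ^ (card (X t) - 1)"
      using finX x by (metis card_gt_0_iff empty_iff power_minus_mult mult.commute)
    ultimately have "m * m ^ (card (X t) - 1) \<le> card (S x) * m ^ (card (X t) - 1) * card \<T>"
      using bound by (metis le_trans mult_le_mono1)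
    then have "m * m ^ (card (X t) - 1) \<le> (card \<T> * card (S x)) * m ^ (card (X t) - 1)"
      by (simp add: ac_simps)
    then show ?thesis using \<open>m > 0\<close> by simp
  qed
  then show ?thesis using t unfolding S_def J_def by blast
qed

text \<open>Sort by decreasing \<open>g\<close> and take every other block of length
  \<open>m\<close>. If two of these blocks are not strictly separated, \<open>g\<close> is constant
  across the skipped block between them, which gives more than \<open>m\<close> ties.\<close>

lemma tied_or_separated:
  fixes g :: "'a \<Rightarrow> real"
  assumes "finite \<A>" and card: "2 * K * m \<le> card \<A>"
  shows "(\<exists>v. m < card {A \<in> \<A>. g A = v}) \<or>
    (\<exists>G. \<forall>i<K. G i \<subseteq> \<A> \<and> card (G i) = m \<and> (\<forall>j<K. i < j \<longrightarrow> (\<forall>A\<in>G i. \<forall>B\<in>G j. g B < g A)))"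
proof (rule disjCI)
  assume notied: "\<not> (\<exists>G. \<forall>i<K. G i \<subseteq> \<A> \<and> card (G i) = m \<and>
    (\<forall>j<K. i < j \<longrightarrow> (\<forall>A\<in>G i. \<forall>B\<in>G j. g B < g A)))"
  obtain xs0 where xs0: "set xs0 = \<A>" "distinct xs0" using finite_distinct_list[OF \<open>finite \<A>\<close>] by blast
  define xs where "xs = sort_key (\<lambda>A. - g A) xs0"
  have xs: "set xs = \<A>" "distinct xs" "sorted (map (\<lambda>A. - g A) xs)"
    using xs0 by (simp_all add: xs_def)
  have len: "length xs = card \<A>" using xs(1,2) distinct_card by fastforce
  have mono: "g (xs ! q) \<le> g (xs ! p)" if "p \<le> q" "q < length xs" for p q
    using sorted_nth_mono[OF xs(3), of p q] that by simp
  define G where "G i = (!) xs ` {2 * i * m..<2 * i * m + m}" for i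
  have range: "2 * i * m + m \<le> length xs" if "i < K" for i
  proof -
    have "2 * i * m + m \<le> 2 * (Suc i) * m" by simp
    also have "\<dots> \<le> 2 * K * m" using that by (intro mult_le_mono) auto
    finally show ?thesis using card len by simp
  qed
  have sub: "G i \<subseteq> \<A>" if "i < K" for i
    using range[OF that] xs(1) by (auto simp: G_def)
  have "card (G i) = m" if "i < K" for i
  proof -
    have "inj_on ((!) xs) {2 * i * m..<2 * i * m + m}"
      using range[OF that] xs(2) by (auto simp: inj_on_def nth_eq_iff_index_eq)
    then show ?thesis by (simp add: G_def card_image)
  qed
  then obtain i j A B where ij: "i < K" "j < K" "i < j" "A \<in> G i" "B \<in> G j" "\<not> g B < g A"
    using notied sub by metis
  obtain p where p: "2 * i * m \<le> p" "p < 2 * i * m + m" "A = xs ! p" using ij(4) by (auto simp: G_def)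
  obtain q where q: "2 * j * m \<le> q" "q < 2 * j * m + m" "B = xs ! q" using ij(5) by (auto simp: G_def)
  have "2 * Suc i * m \<le> 2 * j * m" using \<open>i < j\<close> by (intro mult_le_mono) auto
  then have pq: "p + m < q" using p q by simp
  have qlen: "q < length xs" using q range[OF ij(2)] by simp
  \<comment> \<open>The values descend from \<open>p\<close> to \<open>q\<close> and yet
    \<open>g B\<close> is not below \<open>g A\<close>, so they are all equal.\<close>
  have "g (xs ! l) = g A" if "l \<in> {p..q}" for l
    using mono[of p l] mono[of l q] that qlen ij(6) p(3) q(3) by auto
  then have "(!) xs ` {p..q} \<subseteq> {C \<in> \<A>. g C = g A}"
    using qlen xs(1) by auto
  moreover have "card ((!) xs ` {p..q}) = Suc q - p"
    using qlen xs(2) by (subst card_image) (auto simp: inj_on_def nth_eq_iff_index_eq)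
  ultimately have "Suc q - p \<le> card {C \<in> \<A>. g C = g A}"
    using card_mono[of "{C \<in> \<A>. g C = g A}" "(!) xs ` {p..q}"] \<open>finite \<A>\<close> by simp
  then show "\<exists>v. m < card {A \<in> \<A>. g A = v}" using pq by (intro exI[of _ "g A"]) simp
qed

text \<open>The hypotheses on the arrangement in terms of heights. Allowing \<open>B = C\<close>
  covers comparisons of a body with a single other one.\<close>

definition spread :: "(real^2) set set \<Rightarrow> bool" where
  "spread \<A> \<longleftrightarrow> (\<forall>A\<in>\<A>. body A) \<and> (\<forall>A\<in>\<A>. \<forall>B\<in>\<A>. A \<noteq> B \<longrightarrow> connected (A - B)) \<and>
     (\<forall>A\<in>\<A>. \<forall>B\<in>\<A>. \<forall>C\<in>\<A>. A \<noteq> B \<longrightarrow> A \<noteq> C \<longrightarrow>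
       (\<exists>t. 0 \<le> t \<and> t < 2 * pi \<and> height B t < height A t \<and> height C t < height A t))"

lemma spread_body: "spread \<A> \<Longrightarrow> A \<in> \<A> \<Longrightarrow> body A"
  by (simp add: spread_def)

lemma spread_connected: "spread \<A> \<Longrightarrow> A \<in> \<A> \<Longrightarrow> B \<in> \<A> \<Longrightarrow> A \<noteq> B \<Longrightarrow> connected (A - B)"
  unfolding spread_def by blast

lemma spread_witness:
  assumes "spread \<A>" "A \<in> \<A>" "B \<in> \<A>" "C \<in> \<A>" "A \<noteq> B" "A \<noteq> C"
  obtains t where "0 \<le> t" "t < 2 * pi" "height B t < height A t" "height C t < height A t"
  using assms(1)[unfolded spread_def, THEN conjunct2, THEN conjunct2, rule_format, OF assms(2-6)] that
  by (elim exE conjE)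

lemma spreadI:
  assumes "arrangement \<A>" "non_crossing \<A>" "3 \<le> card \<A>"
    and triples: "\<And>\<T>. \<T> \<subseteq> \<A> \<Longrightarrow> card \<T> = 3 \<Longrightarrow> convexly_independent \<T>"
  shows "spread \<A>"
proof -
  have body: "body A" if "A \<in> \<A>" for A using assms(1) that by (simp add: arrangement_def)
  have conn: "connected (A - B)" if "A \<in> \<A>" "B \<in> \<A>" "A \<noteq> B" for A B
    using assms(2) that unfolding non_crossing_def pairwise_def
    by (blast intro: simply_connected_imp_connected)
  have distinct: "\<exists>t. 0 \<le> t \<and> t < 2 * pi \<and> height B t < height A t \<and> height C t < height A t"
    if "A \<in> \<A>" "B \<in> \<A>" "C \<in> \<A>" "A \<noteq> B" "A \<noteq> C" "B \<noteq> C" for A B C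
  proof -
    have sub: "{A, B, C} \<subseteq> \<A>" using that by simp
    moreover have "card {A, B, C} = 3" using that by simp
    ultimately have ci: "convexly_independent {A, B, C}" by (rule triples)
    have fin: "finite {A, B, C}" by simp
    have ne: "{A, B, C} - {A} \<noteq> {}" using that by blast
    have bodies: "body K" if "K \<in> {A, B, C}" for K using body sub that by blast
    obtain t where "0 \<le> t" "t < 2 * pi" "\<And>L. L \<in> {A, B, C} - {A} \<Longrightarrow> height L t < height A t"
      using convexly_independent_height[OF fin bodies ci _ ne] by blast
    then show ?thesis using that by (intro exI[of _ t]) auto
  qed
  have "\<exists>t. 0 \<le> t \<and> t < 2 * pi \<and> height B t < height A t \<and> height C t < height A t"
    if ABC: "A \<in> \<A>" "B \<in> \<A>" "C \<in> \<A>" "A \<noteq> B" "A \<noteq> C" for A B C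
  proof (cases "B = C")
    case True
    have "card {A, B} \<le> 2" by (simp add: card_insert_le_m1)
    then have "\<not> \<A> \<subseteq> {A, B}" using assms(3) card_mono[of "{A, B}" \<A>] by auto
    \<comment> \<open>A third member turns the pair into a triple; this is where
      \<open>3 \<le> card \<A>\<close> enters.\<close>
    then obtain E where "E \<in> \<A>" "A \<noteq> E" "B \<noteq> E" by blast
    then show ?thesis using distinct[of A B E] ABC True by blast
  next
    case False
    then show ?thesis using distinct ABC by blast
  qed
  then show ?thesis unfolding spread_def using body conn by blast
qed

text \<open>Bodies tied at \<open>0\<close> cannot be ordered there, but no arc on which one of them is higher than
  another contains \<open>0\<close>, so Helly's theorem applies directly.\<close>

lemma tied_clustering:
  assumes \<A>: "spread \<A>" and C: "C \<subseteq> \<A>" "finite C" and tied: "\<And>A. A \<in> C \<Longrightarrow> height A 0 = v"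
    and card: "n * k \<le> card C"
  shows "contains_convex_clustering \<A> n k"
proof -
  have body: "body A" if "A \<in> C" for A using spread_body[OF \<A>] C(1) that by blast
  \<comment> \<open>Every subfamily of \<open>C\<close> is independent, so the blocks of any
    enumeration of \<open>C\<close> form a clustering.\<close>
  have indep: "convexly_independent \<F>" if \<F>: "\<F> \<subseteq> C" for \<F>
  proof (rule convexly_independentI)
    show "body K" if "K \<in> \<F>" for K using body that \<F> by blast
    fix K assume K: "K \<in> \<F>"
    show "\<exists>t. \<forall>L\<in>\<F> - {K}. height L t < height K t"
    proof (cases "\<F> - {K} = {}")
      case True
      then show ?thesis unfolding True by blast
    next
      case False
      define U where "U L = {t \<in> {0<..<2 * pi}. height L t < height K t}" for L
      have "(\<Inter>L\<in>\<F> - {K}. U L) \<noteq> {}"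
      proof (rule Helly_real)
        show "finite (\<F> - {K})" using \<F> C finite_subset by blast
        show "\<F> - {K} \<noteq> {}" by fact
        show "convex (U L)" if "L \<in> \<F> - {K}" for L
          unfolding U_def
        proof (rule convex_height_less)
          have L: "L \<in> \<A>" "K \<in> \<A>" "K \<noteq> L" "L \<in> C" "K \<in> C" using that K \<F> C by auto
          show "body L" "body K" using L body by auto
          show "connected (K - L)" using \<A> L(2,1,3) by (rule spread_connected)
          show "height K 0 \<le> height L 0" using tied L by simp
        qed
        show "U L \<inter> U L' \<noteq> {}" if "L \<in> \<F> - {K}" "L' \<in> \<F> - {K}" for L L'
        proof -
          have L: "L \<in> C" "L' \<in> C" "K \<in> C" "K \<noteq> L" "K \<noteq> L'" using that K \<F> by auto
          then have "L \<in> \<A>" "L' \<in> \<A>" "K \<in> \<A>" using C by auto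
          then obtain t where t: "0 \<le> t" "t < 2 * pi" "height L t < height K t" "height L' t < height K t"
            using spread_witness[OF \<A> _ _ _ L(4,5)] by blast
          \<comment> \<open>Heights tie at \<open>0\<close>, so a strict comparison takes place
            inside the open interval.\<close>
          have "t \<noteq> 0" using t(3) tied[OF L(1)] tied[OF L(3)] by auto
          then have "t \<in> U L \<inter> U L'" using t by (simp add: U_def)
          then show ?thesis by blast
        qed
      qed
      then obtain t where "\<forall>L\<in>\<F> - {K}. t \<in> U L" by blast
      then show ?thesis unfolding U_def by (intro exI[of _ t]) simp
    qed
  qed
  obtain h where h: "bij_betw h {0..<card C} C" using ex_bij_betw_nat_finite[OF C(2)] by blast
  define S where "S i = h ` {(i - 1) * k..<i * k}" for i
  have block: "{(i - 1) * k..<i * k} \<subseteq> {0..<card C}" if "i \<in> {1..n}" for i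
    using that card by (auto intro: less_le_trans order_trans[OF mult_le_mono1])
  have SC: "S i \<subseteq> C" if "i \<in> {1..n}" for i
    using block[OF that] h unfolding S_def bij_betw_def by blast
  have inj: "inj_on h {0..<card C}" using h by (simp add: bij_betw_def)
  have cardS: "card (S i) = k" if "i \<in> {1..n}" for i
  proof -
    have "card (S i) = i * k - (i - 1) * k"
      unfolding S_def using inj_on_subset[OF inj block[OF that]] by (simp add: card_image)
    also have "\<dots> = (i - (i - 1)) * k" by (simp add: diff_mult_distrib)
    finally show ?thesis using that by simp
  qed
  have disj: "disjoint_family_on S {1..n}"
    unfolding disjoint_family_on_def
  proof (intro ballI impI)
    fix i j assume ij: "i \<in> {1..n}" "j \<in> {1..n}" "i \<noteq> j"
    have "{(i - 1) * k..<i * k} \<inter> {(j - 1) * k..<j * k} = {}"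
    proof (cases "i < j")
      case True
      then have "i * k \<le> (j - 1) * k" by (intro mult_le_mono1) simp
      then show ?thesis by auto
    next
      case False
      then have "j * k \<le> (i - 1) * k" using ij(3) by (intro mult_le_mono1) simp
      then show ?thesis by auto
    qed
    then show "S i \<inter> S j = {}"
      unfolding S_def using inj_on_image_Int[OF inj block[OF ij(1)] block[OF ij(2)]] by (metis image_empty)
  qed
  have "convex_clustering n k S"
    unfolding convex_clustering_def
  proof (intro conjI ballI allI impI)
    fix i assume i: "i \<in> {1..n}"
    show "finite (S i)" by (simp add: S_def)
    show "card (S i) = k" by (rule cardS[OF i])
    show "body K" if "K \<in> S i" for K using body SC[OF i] that by blast
  next
    show "disjoint_family_on S {1..n}" by (rule disj)
  next
    fix s assume "\<forall>i\<in>{1..n}. s i \<in> S i"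
    then show "convexly_independent (s ` {1..n})" using SC by (intro indep) blast
  qed
  then show ?thesis
    unfolding contains_convex_clustering_def using SC C(1) by (intro exI[of _ S]) blast
qed

section \<open>Chains in transversals, and classes of transversals with a common pattern\<close>

lemma transversal_admissible:
  assumes \<A>: "spread \<A>" and y: "\<And>i. i \<in> I \<Longrightarrow> y i \<in> \<A>"
    and desc: "\<And>i j. i \<in> I \<Longrightarrow> j \<in> I \<Longrightarrow> i < j \<Longrightarrow> height (y j) 0 < height (y i) 0"
  shows "admissible {0<..<2 * pi} I (\<lambda>i. height (y i))"
  unfolding admissible_def
proof (intro conjI ballI impI)
  fix i j assume ij: "i \<in> I" "j \<in> I" "i < j"
  have ne: "y i \<noteq> y j" using desc[OF ij] by auto
  show "before {0<..<2 * pi} (height (y i)) (height (y j))"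
  proof (rule before_height)
    show "body (y i)" "body (y j)" "connected (y i - y j)" "connected (y j - y i)"
      using spread_body[OF \<A>] spread_connected[OF \<A>] y ij(1,2) ne by simp_all
  qed (rule desc[OF ij])
next
  fix i j k assume ijk: "i \<in> I" "j \<in> I" "k \<in> I" "i < k" "j \<noteq> k"
  have "y k \<noteq> y i" "y k \<noteq> y j"
    using desc[OF ijk(1,3,4)] desc[OF ijk(2,3)] desc[OF ijk(3,2)] ijk(5) by (auto simp: neq_iff)
  from spread_witness[OF \<A> y[OF ijk(3)] y[OF ijk(1)] y[OF ijk(2)] this]
  obtain t where t: "0 \<le> t" "t < 2 * pi"
      "height (y i) t < height (y k) t" "height (y j) t < height (y k) t" .
  \<comment> \<open>At the cut the earlier body \<open>y i\<close> is higher than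
    \<open>y k\<close>, so the direction found is a different one.\<close>
  have "t \<noteq> 0" using t(3) desc[OF ijk(1,3,4)] by auto
  then show "\<exists>t\<in>{0<..<2 * pi}. height (y i) t < height (y k) t \<and> height (y j) t < height (y k) t"
    using t by (intro bexI[of _ t]) auto
qed

text \<open>With a truth value for the sign, the choice between the line and its reflection can be
  part of a finite pattern.\<close>

definition orient :: "bool \<Rightarrow> real" where
  "orient \<sigma> = (if \<sigma> then 1 else -1)"

lemma oriented_uniform_chain_exists:
  "\<exists>K. \<forall>T y. convex T \<and> admissible T {..<K} y \<longrightarrow>
    (\<exists>H b \<sigma> w. H \<subseteq> {..<K} \<and> card H = M \<and>
      uniform_chain ((*) (orient \<sigma>) ` T) b H (\<lambda>i t. y i (orient \<sigma> * t)) w)"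
proof -
  have orient: "\<exists>\<sigma>. uniform_chain ((*) (orient \<sigma>) ` T) b H (\<lambda>i t. y i (orient \<sigma> * t)) w"
    if "uniform_chain T b H y w \<or> uniform_chain (uminus ` T) b H (reflect y) w" for T b H y w
    using that
  proof
    assume "uniform_chain T b H y w"
    then show ?thesis by (intro exI[of _ True]) (simp add: orient_def)
  next
    assume "uniform_chain (uminus ` T) b H (reflect y) w"
    then show ?thesis by (intro exI[of _ False]) (simp add: orient_def)
  qed
  from uniform_chain_exists[of M]
  obtain K where K: "\<forall>T y. convex T \<and> admissible T {..<K} y \<longrightarrow>
    (\<exists>H b w. H \<subseteq> {..<K} \<and> card H = M \<and>
      (uniform_chain T b H y w \<or> uniform_chain (uminus ` T) b H (reflect y) w))"
    by (rule exE)
  show ?thesis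
  proof (rule exI[of _ K], intro allI impI)
    fix T :: "real set" and y assume "convex T \<and> admissible T {..<K} y"
    from K[rule_format, OF this] obtain H b w where H: "H \<subseteq> {..<K}" "card H = M"
      and "uniform_chain T b H y w \<or> uniform_chain (uminus ` T) b H (reflect y) w"
      by (elim exE conjE) (rule that)
    from orient[OF this(3)] obtain \<sigma> where
      "uniform_chain ((*) (orient \<sigma>) ` T) b H (\<lambda>i t. y i (orient \<sigma> * t)) w" by (rule exE)
    with H show "\<exists>H b \<sigma> w. H \<subseteq> {..<K} \<and> card H = M \<and>
      uniform_chain ((*) (orient \<sigma>) ` T) b H (\<lambda>i t. y i (orient \<sigma> * t)) w"
      by (intro exI[of _ H] exI[of _ b] exI[of _ \<sigma>] exI[of _ w] conjI)
  qed
qed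

text \<open>A pattern in \<open>\<T>\<close> consists of the places of a chain, its value
  \<open>b\<close> and its orientation; the witnesses are not part of it.
  \<open>product_pigeonhole\<close> yields a pattern shared by transversals that agree off every
  third place of the chain. The bodies they have at such a place form a class, and
  \<open>chain_exchange\<close> compares bodies taken from different transversals.\<close>

lemma separated_clustering:
  fixes n K k m :: nat
  defines "M \<equiv> 3 * n + 1"
  defines "\<T> \<equiv> {H. H \<subseteq> {..<K} \<and> card H = M} \<times> (UNIV :: bool set) \<times> (UNIV :: bool set)"
  assumes K: "\<forall>T y. convex T \<and> admissible T {..<K} y \<longrightarrow>
    (\<exists>H b \<sigma> w. H \<subseteq> {..<K} \<and> card H = M \<and>
      uniform_chain ((*) (orient \<sigma>) ` T) b H (\<lambda>i t. y i (orient \<sigma> * t)) w)"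
    and \<A>: "spread \<A>" and G: "\<And>i. i < K \<Longrightarrow> G i \<subseteq> \<A> \<and> card (G i) = m"
    and desc: "\<And>i j A B. i < j \<Longrightarrow> j < K \<Longrightarrow> A \<in> G i \<Longrightarrow> B \<in> G j \<Longrightarrow> height B 0 < height A 0"
    and m: "card \<T> * k \<le> m" "0 < m"
  shows "contains_convex_clustering \<A> n k"
proof -
  define T where "T \<sigma> = (*) (orient \<sigma>) ` {0<..<2 * pi}" for \<sigma>
  define z where "z \<sigma> s = (\<lambda>i t. height (s i) (orient \<sigma> * t))" for \<sigma> and s :: "nat \<Rightarrow> (real^2) set"
  have sG: "s i \<in> G i" if "s \<in> PiE {..<K} G" "i < K" for s i
    by (rule PiE_mem[OF that(1)]) (simp add: that(2))
  have GA: "s i \<in> \<A>" if "s \<in> PiE {..<K} G" "i < K" for s i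
    using sG[OF that] G[OF that(2)] by blast
  have adm0: "admissible {0<..<2 * pi} {..<K} (\<lambda>i. height (s i))" if s: "s \<in> PiE {..<K} G" for s
  proof (rule transversal_admissible[OF \<A>])
    show "s i \<in> \<A>" if "i \<in> {..<K}" for i using GA s that by simp
    show "height (s j) 0 < height (s i) 0" if "i \<in> {..<K}" "j \<in> {..<K}" "i < j" for i j
      using desc[of i j "s i" "s j"] sG[OF s] that by simp
  qed
  have adm: "admissible (T \<sigma>) {..<K} (z \<sigma> s)" if "s \<in> PiE {..<K} G" for \<sigma> s
    using adm0[OF that] admissible_reflect[OF adm0[OF that]]
    by (cases \<sigma>) (simp_all add: T_def z_def orient_def)
  define good where "good s p \<longleftrightarrow> (\<exists>H b \<sigma> w. p = (H, b, \<sigma>) \<and> uniform_chain (T \<sigma>) b H (z \<sigma> s) w)" for s p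
  have "\<exists>p. p \<in> \<T> \<and> good s p"
    if s: "s \<in> PiE {..<K} G" for s
  proof -
    have "convex {0<..<2 * pi}" by simp
    then have "convex {0<..<2 * pi} \<and> admissible {0<..<2 * pi} {..<K} (\<lambda>i. height (s i))"
      using adm0[OF s] by (rule conjI)
    from K[rule_format, OF this] obtain H b \<sigma> w where "H \<subseteq> {..<K}" "card H = M"
      "uniform_chain (T \<sigma>) b H (z \<sigma> s) w"
      unfolding T_def[symmetric] z_def[symmetric] by (elim exE conjE) (rule that)
    then have "(H, b, \<sigma>) \<in> \<T>" "good s (H, b, \<sigma>)" unfolding \<T>_def good_def by blast+
    then show ?thesis by blast
  qed
  then have "\<exists>\<tau>. \<forall>s\<in>PiE {..<K} G. \<tau> s \<in> \<T> \<and> good s (\<tau> s)" by (intro bchoice) blast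
  then obtain \<tau> where "\<forall>s\<in>PiE {..<K} G. \<tau> s \<in> \<T> \<and> good s (\<tau> s)" by (rule exE)
  then have \<tau>: "\<tau> s \<in> \<T>" "good s (\<tau> s)" if "s \<in> PiE {..<K} G" for s using that by simp_all
  \<comment> \<open>The varying places are those congruent to 1 modulo 3. One fixed place precedes
    each of them and two follow it, as \<open>chain_exchange\<close> requires; the last one used is
    \<open>3 * n\<close>, whence \<open>M = 3 * n + 1\<close>.\<close>
  define x where "x H c = enumerate H (3 * c + 1)" for H :: "nat set" and c
  define X where "X p = x (fst p) ` {..<n}" for p :: "nat set \<times> bool \<times> bool"
  have en: "bij_betw (enumerate H) {..<M} H" "strict_mono_on {..<M} (enumerate H)"
    if "H \<subseteq> {..<K}" "card H = M" for H
  proof -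
    have fin: "finite H" using that(1) finite_subset by blast
    show "bij_betw (enumerate H) {..<M} H" using finite_bij_enumerate[OF fin] that(2) by simp
    show "strict_mono_on {..<M} (enumerate H)"
      using finite_enumerate_mono[OF _ fin] that(2) by (intro strict_mono_onI) auto
  qed
  have XH: "X p \<subseteq> fst p" "fst p \<subseteq> {..<K}" if "p \<in> \<T>" for p
  proof -
    have H: "fst p \<subseteq> {..<K}" "card (fst p) = M" using that by (auto simp: \<T>_def)
    show "fst p \<subseteq> {..<K}" by (rule H(1))
    show "X p \<subseteq> fst p"
      unfolding X_def x_def
    proof (rule image_subsetI)
      fix c assume "c \<in> {..<n}"
      then have "3 * c + 1 \<in> {..<M}" by (simp add: M_def)
      then show "enumerate (fst p) (3 * c + 1) \<in> fst p" by (rule bij_betwE[OF en(1)[OF H], rule_format])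
    qed
  qed
  have "PiE {..<K} G \<noteq> {}"
  proof
    assume "PiE {..<K} G = {}"
    then obtain i where "i < K" "G i = {}" unfolding PiE_eq_empty_iff by blast
    then show False using G[of i] m(2) by simp
  qed
  then obtain s0 where "s0 \<in> PiE {..<K} G" by blast
  then have ne\<T>: "\<T> \<noteq> {}" using \<tau>(1) by blast
  have "finite {H. H \<subseteq> {..<K} \<and> card H = M}" by (rule finite_subset[of _ "Pow {..<K}"]) auto
  then have fin\<T>: "finite \<T>" by (simp add: \<T>_def)
  have "\<exists>p\<in>\<T>. \<exists>r. \<forall>a\<in>X p. m \<le> card \<T> *
      card {s a | s. s \<in> PiE {..<K} G \<and> \<tau> s = p \<and> (\<forall>i\<in>{..<K} - X p. s i = r i)}"
  proof (rule product_pigeonhole)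
    show "\<tau> \<in> PiE {..<K} G \<rightarrow> \<T>" using \<tau>(1) by blast
    show "X t \<subseteq> {..<K}" if "t \<in> \<T>" for t using XH[OF that] by (rule subset_trans)
  qed (use G m(2) fin\<T> ne\<T> in auto)
  then obtain p r where p: "p \<in> \<T>" and large: "\<And>a. a \<in> X p \<Longrightarrow> m \<le> card \<T> *
      card {s a | s. s \<in> PiE {..<K} G \<and> \<tau> s = p \<and> (\<forall>i\<in>{..<K} - X p. s i = r i)}"
    by blast
  obtain H b \<sigma> where pH: "p = (H, b, \<sigma>)" by (cases p)
  have H: "H \<subseteq> {..<K}" "card H = M" using p pH by (auto simp: \<T>_def)
  define P where "P = H - X p"
  define S where "S a = {s a | s. s \<in> PiE {..<K} G \<and> \<tau> s = p \<and> (\<forall>i\<in>{..<K} - X p. s i = r i)}" for a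
  have lt: "enumerate H i < enumerate H j \<longleftrightarrow> i < j" if "i < M" "j < M" for i j
    using strict_mono_on_less[OF en(2)[OF H]] that by simp
  have inj: "enumerate H i = enumerate H j \<longleftrightarrow> i = j" if "i < M" "j < M" for i j
    using lt[OF that] lt[OF that(2,1)] by (metis less_irrefl linorder_neqE_nat)
  have enH: "enumerate H i \<in> H" if "i < M" for i
    using bij_betw_imp_surj_on[OF en(1)[OF H]] that by blast
  have enP: "enumerate H i \<in> P" if "i < M" "i mod 3 \<noteq> 1" for i
  proof -
    have "enumerate H i \<noteq> x H c" if "c < n" for c
    proof
      assume "enumerate H i = x H c"
      then have "i = 3 * c + 1"
        using inj[OF \<open>i < M\<close>, of "3 * c + 1"] that by (simp add: x_def M_def)
      then show False using \<open>i mod 3 \<noteq> 1\<close> by simp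
    qed
    then show ?thesis using enH[OF that(1)] by (auto simp: P_def X_def pH)
  qed
  have xX: "x H c \<in> X p" if "c < n" for c using that by (simp add: X_def pH)
  have xH: "x H c \<in> H" "x H c < K" if "c < n" for c
    using enH[of "3 * c + 1"] that H by (auto simp: x_def M_def)
  have xP: "x H c \<notin> P" if "c < n" for c using xX[OF that] by (simp add: P_def)
  have x_lt: "x H c < x H c' \<longleftrightarrow> c < c'" if "c < n" "c' < n" for c c'
    using lt[of "3 * c + 1" "3 * c' + 1"] that by (simp add: x_def M_def)
  have sub: "insert (x H c) P \<subseteq> H" if "c < n" for c using xH[OF that] by (auto simp: P_def)
  \<comment> \<open>Each \<open>q c\<close> is taken from its own transversal \<open>s c\<close>,
    with its own witnesses \<open>w c\<close>. All these transversals coincide on \<open>P\<close>,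
    and body \<open>c\<close> is compared with the others at its own witness.\<close>
  have separate: "\<exists>t. \<forall>c'<n. c' \<noteq> c \<longrightarrow> height (q c') t < height (q c) t"
    if q: "\<And>c. c < n \<Longrightarrow> q c \<in> S (x H c)" and c: "c < n" for q c
  proof -
    have "\<exists>s. s \<in> PiE {..<K} G \<and> \<tau> s = p \<and> (\<forall>i\<in>{..<K} - X p. s i = r i) \<and> s (x H d) = q d"
      if "d \<in> {..<n}" for d using q[of d] that unfolding S_def lessThan_iff by blast
    then have "\<exists>s. \<forall>d\<in>{..<n}. s d \<in> PiE {..<K} G \<and> \<tau> (s d) = p \<and>
        (\<forall>i\<in>{..<K} - X p. s d i = r i) \<and> s d (x H d) = q d"
      by (intro bchoice ballI)
    then obtain s where "\<forall>d\<in>{..<n}. s d \<in> PiE {..<K} G \<and> \<tau> (s d) = p \<and>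
        (\<forall>i\<in>{..<K} - X p. s d i = r i) \<and> s d (x H d) = q d"
      by (rule exE)
    then have s: "s d \<in> PiE {..<K} G" "\<tau> (s d) = p" "s d (x H d) = q d"
      "\<And>i. i \<in> {..<K} - X p \<Longrightarrow> s d i = r i" if "d < n" for d
      using that by simp_all
    have "\<exists>w. uniform_chain (T \<sigma>) b H (z \<sigma> (s d)) w" if "d < n" for d
      using \<tau>(2)[OF s(1)[OF that]] unfolding s(2)[OF that] good_def pH by blast
    then have "\<exists>w. \<forall>d\<in>{..<n}. uniform_chain (T \<sigma>) b H (z \<sigma> (s d)) (w d)" by (intro bchoice) simp
    then obtain w where "\<forall>d\<in>{..<n}. uniform_chain (T \<sigma>) b H (z \<sigma> (s d)) (w d)" by (rule exE)
    then have w: "uniform_chain (T \<sigma>) b H (z \<sigma> (s d)) (w d)" if "d < n" for d using that by simp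
    have "height (q c') (orient \<sigma> * w c (x H c)) < height (q c) (orient \<sigma> * w c (x H c))"
      if c': "c' < n" "c' \<noteq> c" for c'
    proof -
      have "z \<sigma> (s c') (x H c') (w c (x H c)) < z \<sigma> (s c) (x H c) (w c (x H c))"
      proof (rule chain_exchange[where T = "T \<sigma>" and b = b and P = P and x = "x H c" and x' = "x H c'"
            and y = "z \<sigma> (s c)" and y' = "z \<sigma> (s c')" and w = "w c" and w' = "w c'"])
        show "uniform_chain (T \<sigma>) b (insert (x H c) P) (z \<sigma> (s c)) (w c)"
          by (rule uniform_chain_subset[OF w[OF c] sub[OF c]])
        show "uniform_chain (T \<sigma>) b (insert (x H c') P) (z \<sigma> (s c')) (w c')"
          by (rule uniform_chain_subset[OF w[OF c'(1)] sub[OF c'(1)]])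
        show "z \<sigma> (s c') i = z \<sigma> (s c) i" if "i \<in> P" for i
        proof -
          have "i \<in> {..<K} - X p" using that H by (auto simp: P_def)
          then show ?thesis using s(4)[OF c] s(4)[OF c'(1)] by (simp add: z_def)
        qed
        show "x H c \<notin> P" "x H c' \<notin> P" using xP c c' by auto
        show "before (T \<sigma>) (z \<sigma> (s c') i) (z \<sigma> (s c') j)"
          if "i \<in> insert (x H c') P" "j \<in> insert (x H c') P" "i < j" for i j
          using adm[OF s(1)[OF c'(1)], of \<sigma>] that sub[OF c'(1)] H(1)
          unfolding admissible_def by blast
        show "x H c \<noteq> x H c'" using x_lt[OF c c'(1)] x_lt[OF c'(1) c] c'(2) by auto
        show "\<exists>u\<in>P. \<exists>u'\<in>P. x H c < u \<and> u < u' \<and> u' < x H c'" if "x H c < x H c'"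
        proof -
          have "c < c'" using x_lt[OF c c'(1)] that by simp
          then have M: "3 * c + 3 < 3 * c' + 1" "3 * c' + 1 < M" using c' by (auto simp: M_def)
          have "x H c < enumerate H (3 * c + 2)" "enumerate H (3 * c + 2) < enumerate H (3 * c + 3)"
            "enumerate H (3 * c + 3) < x H c'" using M by (simp_all add: x_def lt)
          moreover have "enumerate H (3 * c + 2) \<in> P" "enumerate H (3 * c + 3) \<in> P"
            using M by (auto intro!: enP simp: mod_Suc)
          ultimately show ?thesis by blast
        qed
        show "\<exists>a\<in>P. \<exists>p'\<in>P. \<exists>p\<in>P. \<exists>q\<in>P. \<exists>q'\<in>P. a < x H c' \<and> x H c' < p' \<and> p' < p \<and> p < x H c \<and>
          x H c < q \<and> q < q'" if "x H c' < x H c"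
        proof -
          have "c' < c" using x_lt[OF c'(1) c] that by simp
          then have M: "3 * c' + 3 < 3 * c + 1" "3 * c + 3 < M" using c by (auto simp: M_def)
          have "enumerate H (3 * c') < x H c'" "x H c' < enumerate H (3 * c' + 2)"
            "enumerate H (3 * c' + 2) < enumerate H (3 * c' + 3)" "enumerate H (3 * c' + 3) < x H c"
            "x H c < enumerate H (3 * c + 2)" "enumerate H (3 * c + 2) < enumerate H (3 * c + 3)"
            using M by (simp_all add: x_def lt)
          moreover have "enumerate H (3 * c') \<in> P" "enumerate H (3 * c' + 2) \<in> P"
            "enumerate H (3 * c' + 3) \<in> P" "enumerate H (3 * c + 2) \<in> P" "enumerate H (3 * c + 3) \<in> P"
            using M by (auto intro!: enP simp: mod_Suc)
          ultimately show ?thesis by blast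
        qed
      qed
      then show ?thesis using s(3)[OF c] s(3)[OF c'(1)] by (simp add: z_def)
    qed
    then show ?thesis by blast
  qed
  have SG: "S (x H c) \<subseteq> G (x H c)" if "c < n" for c
    using xH[OF that] by (auto simp: S_def PiE_iff)
  have "k \<le> card (S (x H c))" if "c < n" for c
  proof -
    have "card \<T> * k \<le> card \<T> * card (S (x H c))"
      using large[OF xX[OF that]] m(1) unfolding S_def by (rule order_trans[rotated])
    moreover have "0 < card \<T>" using fin\<T> ne\<T> by (simp add: card_gt_0_iff)
    ultimately show ?thesis by simp
  qed
  then have "\<exists>C. C \<subseteq> S (x H c) \<and> card C = k \<and> finite C" if "c \<in> {..<n}" for c
    using obtain_subset_with_card_n[of k "S (x H c)"] that unfolding lessThan_iff by metis
  then have "\<exists>C. \<forall>c\<in>{..<n}. C c \<subseteq> S (x H c) \<and> card (C c) = k \<and> finite (C c)"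
    by (intro bchoice ballI)
  then obtain C where "\<forall>c\<in>{..<n}. C c \<subseteq> S (x H c) \<and> card (C c) = k \<and> finite (C c)"
    by (rule exE)
  then have C: "C c \<subseteq> S (x H c)" "card (C c) = k" "finite (C c)" if "c < n" for c
    using that by simp_all
  \<comment> \<open>Places are counted from 0, the classes of a clustering from 1.\<close>
  define R where "R i = C (i - 1)" for i
  have less: "i - 1 < n" if "i \<in> {1..n}" for i using that by auto
  have R: "R i \<subseteq> S (x H (i - 1))" "card (R i) = k" "finite (R i)" if "i \<in> {1..n}" for i
    using C[OF less[OF that]] by (simp_all add: R_def)
  have R\<A>: "R i \<subseteq> \<A>" if "i \<in> {1..n}" for i
    using R(1)[OF that] SG[OF less[OF that]] G[OF xH(2)[OF less[OF that]]] by blast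
  have body: "body A" if "i \<in> {1..n}" "A \<in> R i" for i A
    using spread_body[OF \<A>] R\<A>[OF that(1)] that(2) by blast
  have "convex_clustering n k R"
    unfolding convex_clustering_def
  proof (intro conjI ballI allI impI)
    show "finite (R i)" "card (R i) = k" if "i \<in> {1..n}" for i using R that by auto
    show "body A" if "i \<in> {1..n}" "A \<in> R i" for i A using body that .
    show "disjoint_family_on R {1..n}"
      unfolding disjoint_family_on_def
    proof (intro ballI impI)
      fix i j assume ij: "i \<in> {1..n}" "j \<in> {1..n}" "i \<noteq> j"
      have disj: "G a \<inter> G b = {}" if "a < b" "b < K" for a b
        using desc[OF that] by fastforce
      have "i - 1 \<noteq> j - 1" using ij by auto
      then have "x H (i - 1) \<noteq> x H (j - 1)"
        using x_lt[OF less[OF ij(1)] less[OF ij(2)]] x_lt[OF less[OF ij(2)] less[OF ij(1)]] by auto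
      then have "G (x H (i - 1)) \<inter> G (x H (j - 1)) = {}"
        using disj xH(2)[OF less[OF ij(1)]] xH(2)[OF less[OF ij(2)]]
        by (metis Int_commute linorder_neqE_nat)
      then show "R i \<inter> R j = {}"
        using R(1)[OF ij(1)] R(1)[OF ij(2)] SG[OF less[OF ij(1)]] SG[OF less[OF ij(2)]] by blast
    qed
    fix s assume s: "\<forall>i\<in>{1..n}. s i \<in> R i"
    show "convexly_independent (s ` {1..n})"
    proof (rule convexly_independentI)
      show "body A" if "A \<in> s ` {1..n}" for A using that s body by blast
      fix A assume "A \<in> s ` {1..n}"
      then obtain i where i: "i \<in> {1..n}" "A = s i" by blast
      have q: "s (Suc c) \<in> S (x H c)" if "c < n" for c
        using s R(1)[of "Suc c"] that by fastforce
      obtain t where t: "\<And>c'. c' < n \<Longrightarrow> c' \<noteq> i - 1 \<Longrightarrow> height (s (Suc c')) t < height (s (Suc (i - 1))) t"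
        using separate[of "\<lambda>c. s (Suc c)" "i - 1"] q less[OF i(1)] by blast
      have "height B t < height A t" if "B \<in> s ` {1..n} - {A}" for B
      proof -
        obtain j where j: "j \<in> {1..n}" "B = s j" "j \<noteq> i" using \<open>B \<in> s ` {1..n} - {A}\<close> i by blast
        then show ?thesis using t[OF less[OF j(1)]] i by auto
      qed
      then show "\<exists>t. \<forall>B\<in>s ` {1..n} - {A}. height B t < height A t" by blast
    qed
  qed
  then show ?thesis
    unfolding contains_convex_clustering_def using R\<A> by (intro exI[of _ R]) blast
qed

theorem theorem4p1:
  fixes n :: nat
  assumes "n > 3"
  shows "\<exists>c::real. c > 0 \<and>
    (\<forall>\<A>. arrangement \<A> \<and> non_crossing \<A> \<and>
         (\<forall>\<T>\<subseteq>\<A>. card \<T> = 3 \<longrightarrow> convexly_independent \<T>)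
       \<longrightarrow> contains_convex_clustering \<A> n (nat \<lfloor>c * real (card \<A>)\<rfloor>))"
proof -
  from oriented_uniform_chain_exists[of "3 * n + 1"]
  obtain K where K: "\<forall>T y. convex T \<and> admissible T {..<K} y \<longrightarrow>
    (\<exists>H b \<sigma> w. H \<subseteq> {..<K} \<and> card H = 3 * n + 1 \<and>
      uniform_chain ((*) (orient \<sigma>) ` T) b H (\<lambda>i t. y i (orient \<sigma> * t)) w)"
    by (rule exE)
  define q where "q = card ({H. H \<subseteq> {..<K} \<and> card H = 3 * n + 1} \<times> (UNIV :: bool set) \<times> (UNIV :: bool set))"
  \<comment> \<open>With \<open>m = (n + q + 1) * k\<close>, the tied case needs
    \<open>n * k \<le> m\<close> and the separated case \<open>q * k \<le> m\<close>. The factor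
    \<open>4 * Suc K\<close> provides the \<open>2 * K * m\<close> bodies for the grouping and, for
    \<open>k > 0\<close>, at least three bodies even if \<open>K = 0\<close>.\<close>
  define L where "L = 4 * Suc K * (n + q + 1)"
  define c where "c = 1 / real L"
  have "0 < L" by (simp add: L_def)
  have "contains_convex_clustering \<A> n (nat \<lfloor>c * real (card \<A>)\<rfloor>)"
    if arr: "arrangement \<A>" and nc: "non_crossing \<A>"
      and triples: "\<forall>\<T>\<subseteq>\<A>. card \<T> = 3 \<longrightarrow> convexly_independent \<T>" for \<A>
  proof -
    define k where "k = nat \<lfloor>c * real (card \<A>)\<rfloor>"
    have "contains_convex_clustering \<A> n k"
    proof (cases "k = 0")
      case True
      \<comment> \<open>Empty classes admit no tuple because the index 1 exists, so their
        independence condition is vacuous.\<close>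
      have "\<not> (\<forall>i\<in>{1..n}. s i \<in> ({} :: (real^2) set set))" for s :: "nat \<Rightarrow> (real^2) set"
        using assms by (intro notI) (drule bspec[of _ _ 1], auto)
      then have "convex_clustering n k (\<lambda>_. {})"
        by (auto simp: convex_clustering_def disjoint_family_on_def True)
      then show ?thesis
        unfolding contains_convex_clustering_def by (intro exI[of _ "\<lambda>_. {}"]) simp
    next
      case False
      have "real k \<le> c * real (card \<A>)" unfolding k_def by (simp add: c_def)
      then have "real (L * k) \<le> real (card \<A>)"
        using \<open>0 < L\<close> by (simp add: c_def field_simps)
      then have Lk: "L * k \<le> card \<A>" by (simp only: of_nat_le_iff)
      define m where "m = (n + q + 1) * k"
      have mpos: "0 < m" using False by (simp add: m_def)
      have "4 * Suc K * m \<le> card \<A>" using Lk unfolding L_def m_def by (simp only: mult.assoc)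
      moreover have "2 * K * m \<le> 4 * Suc K * m" "4 * 1 * 1 \<le> 4 * Suc K * m"
        using mpos by (intro mult_le_mono; simp)+
      ultimately have big: "2 * K * m \<le> card \<A>" "3 \<le> card \<A>" by linarith+
      have fin: "finite \<A>" using arr by (simp add: arrangement_def)
      have sp: "spread \<A>" using spreadI[OF arr nc big(2)] triples by blast
      from tied_or_separated[OF fin big(1), of "\<lambda>A. height A 0"]
      show ?thesis
      proof (elim disjE exE)
        fix v assume "m < card {A \<in> \<A>. height A 0 = v}"
        moreover have "n * k \<le> m" by (simp add: m_def algebra_simps)
        ultimately show ?thesis
          using fin by (intro tied_clustering[OF sp, of "{A \<in> \<A>. height A 0 = v}" v]) auto
      next
        fix G assume G: "\<forall>i<K. G i \<subseteq> \<A> \<and> card (G i) = m \<and>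
          (\<forall>j<K. i < j \<longrightarrow> (\<forall>A\<in>G i. \<forall>B\<in>G j. height B 0 < height A 0))"
        show ?thesis
        proof (rule separated_clustering[OF K sp])
          show "G i \<subseteq> \<A> \<and> card (G i) = m" if "i < K" for i using G that by blast
          show "height B 0 < height A 0" if "i < j" "j < K" "A \<in> G i" "B \<in> G j" for i j A B
            using G that less_trans[OF that(1,2)] by blast
          show "card ({H. H \<subseteq> {..<K} \<and> card H = 3 * n + 1} \<times> (UNIV :: bool set) \<times> (UNIV :: bool set)) * k \<le> m"
            unfolding q_def[symmetric] by (simp add: m_def algebra_simps)
        qed (rule mpos)
      qed
    qed
    then show ?thesis by (simp add: k_def)
  qed
  moreover have "0 < c" using \<open>0 < L\<close> by (simp add: c_def)
  ultimately show ?thesis by (intro exI[of _ c]) blast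
qed

end
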